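(* Let $\mathcal{H}_1$ and $\mathcal{H}_2$ be finite-dimensional Hilbert spaces. Let $C$ be a Hermitian operator on $\mathcal{H}_1\otimes\mathcal{H}_2$, and let $\rho\in\mathrm{H}_{\geq}(\mathcal{H}_1)$, $\sigma\in\mathrm{H}_{\geq}(\mathcal{H}_2)$ be Hermitian positive semi-definite operators. (i) Fix $\tau_1,\tau_2>0$ and for each $\varepsilon>0$ let $\Gamma^\varepsilon$ be a minimizer of $\mathcal{F}^{\tau_1,\tau_2}_{\varepsilon}$ over $\mathrm{H}_{\geq}(\mathcal{H}_1\otimes\mathcal{H}_2)$. Then there exists $\Gamma^0\in\mathrm{H}_{\geq}(\mathcal{H}_1\otimes\mathcal{H}_2)$ such that, up to taking subsequences, $\Gamma^\varepsilon\rightharpoonup^*\Gamma^0$ as $\varepsilon\to0^+$, and $$\lim_{\varepsilon\to0^+}\mathcal{F}^{\tau_1,\tau_2}_{\varepsilon}(\Gamma^\varepsilon)=\min_{\Gamma\in\mathrm{H}_{\geq}(\mathcal{H}_1\otimes\mathcal{H}_2)}\mathcal{F}^{\tau_1,\tau_2}_0(\Gamma)=\mathcal{F}^{\tau_1,\tau_2}_0(\Gamma^0).$$ (ii) Fix $\varepsilon>0$ and for each $\tau>0$ let $\Gamma^\tau$ be a minimizer of $\mathcal{F}^{\tau}_{\varepsilon}$ over $\mathrm{H}_{\geq}(\mathcal{H}_1\otimes\mathcal{H}_2)$. If $\mathrm{Tr}[\rho]=\mathrm{Tr}[\sigma]$, then there exists $\Gamma^\infty\in\mathrm{H}_{\geq}(\mathcal{H}_1\otimes\mathcal{H}_2)$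 such that, up to taking subsequences, $\Gamma^\tau\rightharpoonup^*\Gamma^\infty$ as $\tau\to+\infty$, and $$\lim_{\tau\to+\infty}\mathcal{F}^{\tau}_{\varepsilon}(\Gamma^\tau)=\min\left\{\mathcal{F}^{\infty}_{\varepsilon}(\Gamma)\ :\ \Gamma\in\mathrm{H}_{\geq}(\mathcal{H}_1\otimes\mathcal{H}_2),\ \Gamma_1=\rho,\ \Gamma_2=\sigma\right\}=\mathcal{F}^{\infty}_{\varepsilon}(\Gamma^\infty),$$ which, provided that $\rho$ and $\sigma$ are density matrices, coincides with the solution of the von Neumann entropy regularized Non-commutative Optimal Transport problem $\inf\{\mathrm{Tr}[C\Gamma]+\varepsilon\mathcal{S}[\Gamma]\ :\ \Gamma\mapsto(\rho,\sigma)\}$.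
   Context: $\mathrm{H}_{\geq}(\mathcal{H})$ is the set of Hermitian positive semi-definite operators on $\mathcal{H}$. For $\Gamma\in\mathrm{H}_{\geq}(\mathcal{H}_1\otimes\mathcal{H}_2)$, the partial traces are $\Gamma_1=\mathrm{Tr}_2[\Gamma]$ (on $\mathcal{H}_1$) and $\Gamma_2=\mathrm{Tr}_1[\Gamma]$ (on $\mathcal{H}_2$). $\Gamma\mapsto(\rho,\sigma)$ means that $\Gamma$ is a density matrix (positive semi-definite, trace one) on $\mathcal{H}_1\otimes\mathcal{H}_2$ with $\Gamma_1=\rho$ and $\Gamma_2=\sigma$. $\rightharpoonup^*$ denotes weak* convergence of operators (equivalent to norm convergence in this finite-dimensional setting); "up to taking subsequences" means along some sequence $\varepsilon_k\to0^+$ (resp. $\tau_h\to+\infty$). The von Neumann entropy is $\mathcal{S}[\Gamma]=\mathrm{Tr}[\Gamma(\log\Gamma-\mathrm{Id})]$. The Umegaki relative entropy of $\gamma_1,\gamma_2\in\mathrm{H}_{\geq}(\mathcal{H})$ is $$\mathcal{E}[\gamma_1|\gamma_2]=\mathrm{Tr}[\gamma_1(\log\gamma_1-\log\gamma_2-\mathrm{Id})+\gamma_2]\ \text{ if }\ker\gamma_2\subset\ker\gamma_1,\qquad \mathcal{E}[\gamma_1|\gamma_2]=+\infty\ \text{ otherwise},$$ with $0\log0=0$ ($\mathrm{Tr}[\gamma_1\log\gamma_2]$ being computed on the range of $\gamma_2$). The functionals on $\mathrm{H}_{\geq}(\mathcal{H}_1\otimes\mathcal{H}_2)$, with values in $\mathbb{R}\cup\{+\infty\}$,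 are $$\mathcal{F}^{\tau_1,\tau_2}_{\varepsilon}(\Gamma)=\mathrm{Tr}[C\Gamma]+\varepsilon\mathcal{S}[\Gamma]+\tau_1\mathcal{E}[\Gamma_1|\rho]+\tau_2\mathcal{E}[\Gamma_2|\sigma],\qquad \mathcal{F}^{\tau}_{\varepsilon}=\mathcal{F}^{\tau,\tau}_{\varepsilon},$$ $$\mathcal{F}^{\tau_1,\tau_2}_0(\Gamma)=\mathrm{Tr}[C\Gamma]+\tau_1\mathcal{E}[\Gamma_1|\rho]+\tau_2\mathcal{E}[\Gamma_2|\sigma],$$ $$\mathcal{F}^{\infty}_{\varepsilon}(\Gamma)=\mathrm{Tr}[C\Gamma]+\varepsilon\mathcal{S}[\Gamma]\ \text{ if }\Gamma_1=\rho\text{ and }\Gamma_2=\sigma,\qquad \mathcal{F}^{\infty}_{\varepsilon}(\Gamma)=+\infty\ \text{ otherwise}.$$ *)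

theory Defs
  imports "HOL-Analysis.Analysis"
begin

text \<open>
  A finite-dimensional Hilbert space is taken to be the coordinate space \<open>complex ^ 'n\<close> with its
  standard Hermitian inner product, operators are square matrices, and the tensor product of
  \<open>complex ^ 'a\<close> and \<open>complex ^ 'b\<close> is \<open>complex ^ ('a \<times> 'b)\<close>.
\<close>

definition cadjoint :: "complex ^ 'n ^ 'm \<Rightarrow> complex ^ 'm ^ 'n" where
  "cadjoint A = (\<chi> i j. cnj (A $ j $ i))"

definition hermitian :: "complex ^ 'n ^ 'n \<Rightarrow> bool" where
  "hermitian A \<longleftrightarrow> cadjoint A = A"

definition cinner :: "complex ^ 'n \<Rightarrow> complex ^ 'n \<Rightarrow> complex" where
  "cinner x y = (\<Sum>i\<in>UNIV. cnj (x $ i) * y $ i)"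

definition psd :: "complex ^ 'n ^ 'n \<Rightarrow> bool" where
  "psd A \<longleftrightarrow> hermitian A \<and> (\<forall>x. 0 \<le> Re (cinner x (A *v x)))"

definition density_matrix :: "complex ^ 'n ^ 'n \<Rightarrow> bool" where
  "density_matrix A \<longleftrightarrow> psd A \<and> trace A = 1"

definition unitary_matrix :: "complex ^ 'n ^ 'n \<Rightarrow> bool" where
  "unitary_matrix U \<longleftrightarrow> cadjoint U ** U = mat 1 \<and> U ** cadjoint U = mat 1"

definition real_diag :: "('n \<Rightarrow> real) \<Rightarrow> complex ^ 'n ^ 'n" where
  "real_diag d = (\<chi> i j. if i = j then of_real (d i) else 0)"

text \<open>
  Functional calculus of a Hermitian matrix. By \<open>herm_fun_diagonalized\<close> below the result does
  not depend on the diagonalization; on non-Hermitian matrices it is unspecified.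
\<close>

definition herm_fun :: "(real \<Rightarrow> real) \<Rightarrow> complex ^ 'n ^ 'n \<Rightarrow> complex ^ 'n ^ 'n" where
  "herm_fun f A = (THE B. \<exists>U d. unitary_matrix U \<and> A = U ** real_diag d ** cadjoint U
                              \<and> B = U ** real_diag (\<lambda>i. f (d i)) ** cadjoint U)"

lemma real_diag_intertwine:
  assumes "W ** real_diag d = real_diag e ** W"
  shows "W ** real_diag (\<lambda>i. f (d i)) = real_diag (\<lambda>i. f (e i)) ** W"
proof -
  have l: "(W ** real_diag g) $ i $ j = W $ i $ j * of_real (g j)" for g i j
    by (simp add: matrix_matrix_mult_def real_diag_def if_distrib cong: if_cong)
  have r: "(real_diag g ** W) $ i $ j = of_real (g i) * W $ i $ j" for g i j
    by (simp add: matrix_matrix_mult_def real_diag_def if_distrib[of "\<lambda>x. x * _"] cong: if_cong)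
  have "W $ i $ j * of_real (d j) = of_real (e i) * W $ i $ j" for i j
    using assms l r by metis
  then have "W $ i $ j = 0 \<or> d j = e i" for i j
    by (metis mult.commute mult_cancel_left of_real_eq_iff)
  then have "W $ i $ j * of_real (f (d j)) = of_real (f (e i)) * W $ i $ j" for i j
    by (metis mult.commute mult_zero_left)
  then show ?thesis
    by (simp add: vec_eq_iff l r)
qed

lemma herm_fun_diagonalized:
  assumes U: "unitary_matrix U"
  shows "herm_fun f (U ** real_diag d ** cadjoint U) = U ** real_diag (\<lambda>i. f (d i)) ** cadjoint U"
  unfolding herm_fun_def
proof (rule the_equality)
  show "\<exists>V e. unitary_matrix V \<and> U ** real_diag d ** cadjoint U = V ** real_diag e ** cadjoint V
      \<and> U ** real_diag (\<lambda>i. f (d i)) ** cadjoint U = V ** real_diag (\<lambda>i. f (e i)) ** cadjoint V"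
    using U by blast
next
  fix B
  assume "\<exists>V e. unitary_matrix V \<and> U ** real_diag d ** cadjoint U = V ** real_diag e ** cadjoint V
      \<and> B = V ** real_diag (\<lambda>i. f (e i)) ** cadjoint V"
  then obtain V e where V: "unitary_matrix V"
    and eq: "U ** real_diag d ** cadjoint U = V ** real_diag e ** cadjoint V"
    and B: "B = V ** real_diag (\<lambda>i. f (e i)) ** cadjoint V"
    by blast
  have u: "cadjoint U ** U = mat 1" "U ** cadjoint U = mat 1"
    and v: "cadjoint V ** V = mat 1" "V ** cadjoint V = mat 1"
    using U V by (auto simp: unitary_matrix_def)
  define W where "W = cadjoint V ** U"
  have "W ** real_diag d = cadjoint V ** (U ** real_diag d ** cadjoint U) ** U"
    by (simp add: W_def u flip: matrix_mul_assoc)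
  also have "\<dots> = (cadjoint V ** V) ** real_diag e ** W"
    by (simp only: eq W_def matrix_mul_assoc)
  finally have "W ** real_diag d = real_diag e ** W"
    by (simp add: v)
  then have w: "W ** real_diag (\<lambda>i. f (d i)) = real_diag (\<lambda>i. f (e i)) ** W"
    by (rule real_diag_intertwine)
  have "U ** real_diag (\<lambda>i. f (d i)) ** cadjoint U
      = V ** (W ** real_diag (\<lambda>i. f (d i))) ** cadjoint U"
    by (simp add: W_def v matrix_mul_assoc)
  also have "\<dots> = V ** real_diag (\<lambda>i. f (e i)) ** cadjoint V ** (U ** cadjoint U)"
    by (simp only: w) (simp only: W_def matrix_mul_assoc)
  finally show "B = U ** real_diag (\<lambda>i. f (d i)) ** cadjoint U"
    by (simp add: B u)
qed

text \<open>
  The logarithm is set to 0 on the kernel: this yields \<open>0 log 0 = 0\<close> in \<open>\<Gamma> log \<Gamma>\<close>, and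
  \<open>Tr [\<gamma>\<^sub>1 log \<gamma>\<^sub>2]\<close> is computed on the range of \<open>\<gamma>\<^sub>2\<close>.
\<close>

definition mlog :: "complex ^ 'n ^ 'n \<Rightarrow> complex ^ 'n ^ 'n" where
  "mlog = herm_fun (\<lambda>x. if x > 0 then ln x else 0)"

text \<open>All traces below are real for Hermitian arguments; \<open>Re\<close> only adjusts the type.\<close>

definition rtrace :: "complex ^ 'n ^ 'n \<Rightarrow> real" where
  "rtrace A = Re (trace A)"

text \<open>\<open>marginal1\<close> is the partial trace over the second factor, \<open>marginal2\<close> that over the first.\<close>

definition marginal1 :: "complex ^ ('a::finite \<times> 'b::finite) ^ ('a \<times> 'b) \<Rightarrow> complex ^ 'a ^ 'a" where
  "marginal1 \<Gamma> = (\<chi> i j. \<Sum>k\<in>UNIV. \<Gamma> $ (i, k) $ (j, k))"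

definition marginal2 :: "complex ^ ('a::finite \<times> 'b::finite) ^ ('a \<times> 'b) \<Rightarrow> complex ^ 'b ^ 'b" where
  "marginal2 \<Gamma> = (\<chi> k l. \<Sum>i\<in>UNIV. \<Gamma> $ (i, k) $ (i, l))"

definition couples ::
  "complex ^ ('a::finite \<times> 'b::finite) ^ ('a \<times> 'b) \<Rightarrow> complex ^ 'a ^ 'a \<Rightarrow> complex ^ 'b ^ 'b \<Rightarrow> bool" where
  "couples \<Gamma> \<rho> \<sigma> \<longleftrightarrow> density_matrix \<Gamma> \<and> marginal1 \<Gamma> = \<rho> \<and> marginal2 \<Gamma> = \<sigma>"

definition vn_entropy :: "complex ^ 'n ^ 'n \<Rightarrow> real" where
  "vn_entropy \<Gamma> = rtrace (\<Gamma> ** (mlog \<Gamma> - mat 1))"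

definition mat_ker :: "complex ^ 'n ^ 'n \<Rightarrow> (complex ^ 'n) set" where
  "mat_ker A = {x. A *v x = 0}"

definition rel_entropy :: "complex ^ 'n ^ 'n \<Rightarrow> complex ^ 'n ^ 'n \<Rightarrow> ereal" where
  "rel_entropy \<gamma>1 \<gamma>2 =
     (if mat_ker \<gamma>2 \<subseteq> mat_ker \<gamma>1
      then ereal (rtrace (\<gamma>1 ** (mlog \<gamma>1 - mlog \<gamma>2 - mat 1) + \<gamma>2))
      else \<infinity>)"

definition F_unbalanced ::
  "complex ^ ('a::finite \<times> 'b::finite) ^ ('a \<times> 'b) \<Rightarrow> complex ^ 'a ^ 'a \<Rightarrow> complex ^ 'b ^ 'b
     \<Rightarrow> real \<Rightarrow> real \<Rightarrow> real \<Rightarrow> complex ^ ('a::finite \<times> 'b::finite) ^ ('a \<times> 'b) \<Rightarrow> ereal" where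
  "F_unbalanced C \<rho> \<sigma> \<tau>1 \<tau>2 \<epsilon> \<Gamma> =
     ereal (rtrace (C ** \<Gamma>)) + ereal \<epsilon> * ereal (vn_entropy \<Gamma>)
     + ereal \<tau>1 * rel_entropy (marginal1 \<Gamma>) \<rho> + ereal \<tau>2 * rel_entropy (marginal2 \<Gamma>) \<sigma>"

definition F_unbalanced0 ::
  "complex ^ ('a::finite \<times> 'b::finite) ^ ('a \<times> 'b) \<Rightarrow> complex ^ 'a ^ 'a \<Rightarrow> complex ^ 'b ^ 'b
     \<Rightarrow> real \<Rightarrow> real \<Rightarrow> complex ^ ('a::finite \<times> 'b::finite) ^ ('a \<times> 'b) \<Rightarrow> ereal" where
  "F_unbalanced0 C \<rho> \<sigma> \<tau>1 \<tau>2 \<Gamma> =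
     ereal (rtrace (C ** \<Gamma>))
     + ereal \<tau>1 * rel_entropy (marginal1 \<Gamma>) \<rho> + ereal \<tau>2 * rel_entropy (marginal2 \<Gamma>) \<sigma>"

definition F_balanced ::
  "complex ^ ('a::finite \<times> 'b::finite) ^ ('a \<times> 'b) \<Rightarrow> complex ^ 'a ^ 'a \<Rightarrow> complex ^ 'b ^ 'b
     \<Rightarrow> real \<Rightarrow> complex ^ ('a::finite \<times> 'b::finite) ^ ('a \<times> 'b) \<Rightarrow> ereal" where
  "F_balanced C \<rho> \<sigma> \<epsilon> \<Gamma> =
     (if marginal1 \<Gamma> = \<rho> \<and> marginal2 \<Gamma> = \<sigma>
      then ereal (rtrace (C ** \<Gamma>) + \<epsilon> * vn_entropy \<Gamma>)
      else \<infinity>)"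

text \<open>Weak* convergence, testing against every operator (all are compact in finite dimension).\<close>

definition weakstar_limit :: "(nat \<Rightarrow> complex ^ 'n ^ 'n) \<Rightarrow> complex ^ 'n ^ 'n \<Rightarrow> bool" where
  "weakstar_limit X L \<longleftrightarrow> (\<forall>K. (\<lambda>k. trace (K ** X k)) \<longlonglongrightarrow> trace (K ** L))"

end

theory Submission
  imports Defs "HOL-Real_Asymp.Real_Asymp"
begin

text \<open>
  Traces of functions of Hermitian matrices become sums over eigenvalues. Since the Legendre
  transform of \<open>x \<mapsto> x ln x - x\<close> is \<open>exp\<close>, the entropy dominates every multiple of the trace up to
  a constant, so all minimizers considered have bounded trace and subsequences converge. Along them
  all terms are continuous, because finiteness of the relative entropies forces the closed kernel
  conditions \<open>ker \<rho> \<subseteq> ker \<Gamma>\<^sub>1\<close> and \<open>ker \<sigma> \<subseteq> ker \<Gamma>\<^sub>2\<close>. In (i) the minimal values are squeezed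
  between \<open>min F\<^sub>0 - \<epsilon> dim\<close> and \<open>F\<^sub>0(\<Gamma>\<^sup>0) + \<epsilon> S(\<Gamma>\<^sup>0)\<close>. In (ii) they are nondecreasing in \<open>\<tau>\<close> and
  bounded by the cost of the coupling \<open>\<rho> \<otimes> \<sigma> / Tr \<rho>\<close>; hence both relative entropies are
  \<open>O(1/\<tau>)\<close>, and the equality case of Klein's inequality identifies the limiting marginals.
\<close>

section \<open>Spectral theorem\<close>

lemma Re_cinner: "Re (cinner x y) = x \<bullet> y"
  by (simp add: cinner_def inner_vec_def inner_complex_def)

lemma cinner_adjoint: "cinner (cadjoint A *v x) y = cinner x (A *v y)"
proof -
  have "cinner (cadjoint A *v x) y = (\<Sum>i\<in>UNIV. \<Sum>j\<in>UNIV. A $ j $ i * cnj (x $ j) * y $ i)"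
    by (simp add: cinner_def cadjoint_def matrix_vector_mult_def sum_distrib_right)
  also have "\<dots> = (\<Sum>j\<in>UNIV. \<Sum>i\<in>UNIV. A $ j $ i * cnj (x $ j) * y $ i)"
    by (rule sum.swap)
  also have "\<dots> = cinner x (A *v y)"
    by (simp add: cinner_def matrix_vector_mult_def sum_distrib_left mult_ac)
  finally show ?thesis .
qed

lemma cinner_commute: "cinner y x = cnj (cinner x y)"
  by (simp add: cinner_def mult.commute)

lemma cinner_scale_left: "cinner (c *s x) y = cnj c * cinner x y"
  by (simp add: cinner_def sum_distrib_left mult_ac)

lemma cinner_self: "cinner x x = of_real (x \<bullet> x)"
  unfolding cinner_def inner_vec_def of_real_sum
  by (intro sum.cong refl) (simp add: complex_eq_iff inner_complex_def)

lemma inner_adjoint: "(cadjoint A *v x) \<bullet> y = x \<bullet> (A *v y)"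
  using cinner_adjoint[of A x y] by (simp flip: Re_cinner)

lemma cadjoint_nth [simp]: "cadjoint A $ i $ j = cnj (A $ j $ i)"
  by (simp add: cadjoint_def)

lemma cadjoint_cadjoint [simp]: "cadjoint (cadjoint A) = A"
  by (simp add: vec_eq_iff)

lemma cadjoint_mult: "cadjoint (A ** B) = cadjoint B ** cadjoint A"
  by (simp add: vec_eq_iff matrix_matrix_mult_def mult.commute)

lemma real_diag_nth: "real_diag d $ i $ j = (if i = j then of_real (d i) else 0)"
  by (simp add: real_diag_def)

lemma hermitian_real_diag: "cadjoint (real_diag d) = real_diag d"
  by (simp add: vec_eq_iff real_diag_nth)

lemma mult_real_diag_nth: "(A ** real_diag d) $ i $ j = A $ i $ j * of_real (d j)"
  by (simp add: matrix_matrix_mult_def real_diag_def if_distrib cong: if_cong)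

lemma real_diag_mult_nth: "(real_diag d ** A) $ i $ j = of_real (d i) * A $ i $ j"
  by (simp add: matrix_matrix_mult_def real_diag_def if_distrib[of "\<lambda>x. x * _"] cong: if_cong)

text \<open>First-order condition for a maximiser: if \<open>b\<close> were nonzero, a small step
  against its sign would let the linear term dominate. The step size 1/(1 + |c|) is small enough to
  ensure \<open>s * c < 2\<close>.\<close>

lemma quadratic_nonneg_imp_linear_zero:
  fixes b c :: real
  assumes "\<And>t. 0 \<le> 2 * t * b + t\<^sup>2 * c"
  shows "b = 0"
proof (rule ccontr)
  assume b: "b \<noteq> 0"
  define s where "s = 1 / (1 + \<bar>c\<bar>)"
  have s: "s > 0" "s * c < 2" "s * \<bar>c\<bar> \<le> 1"
    by (auto simp: s_def field_simps abs_if)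
  have "0 \<le> 2 * (- s * b) * b + (- s * b)\<^sup>2 * c" by (rule assms)
  also have "\<dots> = s * b\<^sup>2 * (s * c - 2)" by (simp add: power2_eq_square algebra_simps)
  finally have "0 \<le> s * b\<^sup>2 * (s * c - 2)" .
  moreover have "s * b\<^sup>2 * (s * c - 2) < 0"
    using s b by (intro mult_pos_neg) auto
  ultimately show False by simp
qed

lemma hermitian_inner:
  assumes "hermitian A"
  shows "(A *v x) \<bullet> y = x \<bullet> (A *v y)"
  using inner_adjoint[of A x y] assms by (simp add: hermitian_def)

text \<open>A maximiser of the quadratic form on the unit sphere of an invariant subspace is an eigenvector.\<close>

lemma exists_eigenvector_in_invariant_kernel:
  fixes A :: "complex ^ 'n ^ 'n" and M :: "complex ^ 'n ^ 'm"
  assumes A: "hermitian A" and inv: "\<And>x. M *v x = 0 \<Longrightarrow> M *v (A *v x) = 0"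
    and x0: "M *v x0 = 0" "x0 \<noteq> 0"
  shows "\<exists>x l. M *v x = 0 \<and> x \<bullet> x = 1 \<and> A *v x = of_real l *s x"
proof -
  let ?W = "{x. M *v x = 0}"
  let ?Q = "\<lambda>x. x \<bullet> (A *v x)"
  interpret M: bounded_linear "(*v) M" by simp
  interpret A: bounded_linear "(*v) A" by simp
  have contM: "continuous_on UNIV ((*v) M)" and contA: "continuous_on S ((*v) A)" for S
    by (auto intro: linear_continuous_on)
  have "compact (sphere 0 1 \<inter> ?W)"
    using continuous_closed_preimage[OF contM, of "{0}"]
    by (intro compact_Int_closed) (auto simp: vimage_def)
  moreover have "(1 / norm x0) *\<^sub>R x0 \<in> sphere 0 1 \<inter> ?W"
    using x0 by (simp add: M.scaleR)
  moreover have "continuous_on (sphere 0 1 \<inter> ?W) ?Q"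
    by (intro continuous_intros contA)
  ultimately obtain x where x: "x \<in> sphere 0 1 \<inter> ?W"
    and max: "\<And>y. y \<in> sphere 0 1 \<inter> ?W \<Longrightarrow> ?Q y \<le> ?Q x"
    using continuous_attains_sup[of "sphere 0 1 \<inter> ?W" ?Q] by blast
  define l where "l = ?Q x"
  have xx: "x \<bullet> x = 1" and Wx: "M *v x = 0"
    using x by (auto simp: norm_eq_1)
  have Q_le: "?Q y \<le> l * (y \<bullet> y)" if "M *v y = 0" for y
  proof (cases "y = 0")
    case False
    have "?Q ((1 / norm y) *\<^sub>R y) \<le> l"
      unfolding l_def using that False by (intro max) (simp add: M.scaleR)
    then have "?Q y / (norm y * norm y) \<le> l"
      by (simp add: A.scaleR)
    then show ?thesis
      using False by (simp add: divide_le_eq dot_square_norm power2_eq_square)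
  qed simp
  \<comment> \<open>\<open>z\<close> is the residual of the eigenvalue equation. It stays in the
    invariant kernel, so \<open>x\<close> may be perturbed along it, and the linear term of that
    perturbation is \<open>z \<bullet> z\<close>.\<close>
  define z where "z = l *\<^sub>R x - A *v x"
  have Wz: "M *v z = 0"
    by (simp add: z_def M.diff M.scaleR Wx inv)
  have "0 \<le> 2 * t * (z \<bullet> z) + t\<^sup>2 * (l * (z \<bullet> z) - ?Q z)" for t
  proof -
    have "M *v (x + t *\<^sub>R z) = 0"
      by (simp add: M.add M.scaleR Wx Wz)
    then have "0 \<le> l * ((x + t *\<^sub>R z) \<bullet> (x + t *\<^sub>R z)) - ?Q (x + t *\<^sub>R z)"
      using Q_le by simp
    moreover have Axz: "(A *v x) \<bullet> z = l * (x \<bullet> z) - z \<bullet> z"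
      by (subst (3) z_def) (simp add: inner_diff_left)
    moreover have "x \<bullet> (A *v z) = l * (x \<bullet> z) - z \<bullet> z" "z \<bullet> (A *v x) = l * (x \<bullet> z) - z \<bullet> z"
      using hermitian_inner[OF A, of x z] Axz by (simp_all add: inner_commute)
    ultimately show ?thesis
      by (simp add: A.add A.scaleR inner_add_left inner_add_right xx l_def[symmetric]
          power2_eq_square algebra_simps inner_commute[of z x])
  qed
  then have "z \<bullet> z = 0"
    by (rule quadratic_nonneg_imp_linear_zero)
  then have "A *v x = of_real l *s x"
    by (simp add: z_def vec_eq_iff scaleR_conv_of_real[where 'a=complex])
  then show ?thesis
    using Wx xx by blast
qed

text \<open>Induction on the index set: the orthogonal complement of the eigenvectors already found
  is invariant because \<open>A\<close> is Hermitian, and nonzero because an index is still missing,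
  so it contains a further eigenvector.\<close>

lemma hermitian_orthonormal_eigenvectors:
  fixes A :: "complex ^ 'n ^ 'n" and I :: "'n set"
  assumes A: "hermitian A"
  shows "\<exists>(u :: 'n \<Rightarrow> complex ^ 'n) d. (\<forall>i\<in>I. A *v u i = of_real (d i) *s u i)
    \<and> (\<forall>i\<in>I. \<forall>j\<in>I. cinner (u i) (u j) = (if i = j then 1 else 0))"
  using finite[of I]
proof (induction I rule: finite_induct)
  case (insert k I)
  then obtain u :: "'n \<Rightarrow> complex ^ 'n" and d :: "'n \<Rightarrow> real"
    where e: "\<And>i. i \<in> I \<Longrightarrow> A *v u i = of_real (d i) *s u i"
      and o: "\<And>i j. i \<in> I \<Longrightarrow> j \<in> I \<Longrightarrow> cinner (u i) (u j) = (if i = j then 1 else 0)"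
    by blast
  \<comment> \<open>The kernel of \<open>M\<close> is the orthogonal complement of the vectors
    \<open>u i\<close> with \<open>i \<in> I\<close>. Padding with zero rows keeps \<open>M\<close>
    square; its row \<open>k\<close> is zero, so \<open>M\<close> is singular and the complement is
    nontrivial.\<close>
  define M :: "complex ^ 'n ^ 'n" where "M = (\<chi> i j. if i \<in> I then cnj (u i $ j) else 0)"
  have M: "M *v x = 0 \<longleftrightarrow> (\<forall>i\<in>I. cinner (u i) x = 0)" for x
  proof -
    have "(M *v x) $ i = (if i \<in> I then cinner (u i) x else 0)" for i
      by (simp add: M_def matrix_vector_mult_def cinner_def)
    then show ?thesis
      by (auto simp: vec_eq_iff)
  qed
  have Mk: "(M ** B) $ k $ k = 0" for B
    using insert.hyps by (simp add: M_def matrix_matrix_mult_def)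
  have "M ** B \<noteq> mat 1" for B
  proof
    assume "M ** B = mat 1"
    then have "(M ** B) $ k $ k = 1" by (simp add: mat_def)
    then show False using Mk by simp
  qed
  then have "\<nexists>B. B ** M = mat 1"
    using matrix_left_right_inverse by blast
  then obtain x0 where x0: "M *v x0 = 0" "x0 \<noteq> 0"
    using matrix_left_invertible_ker by blast
  have "M *v (A *v x) = 0" if "M *v x = 0" for x
  proof -
    have "cinner (u i) (A *v x) = 0" if "i \<in> I" for i
    proof -
      have "cinner (u i) (A *v x) = cinner (A *v u i) x"
        using cinner_adjoint[of A "u i" x] A by (simp add: hermitian_def)
      then show ?thesis
        using \<open>M *v x = 0\<close> that by (simp add: M e cinner_scale_left)
    qed
    then show ?thesis by (simp add: M)
  qed
  from exists_eigenvector_in_invariant_kernel[OF A this x0]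
  obtain x l where x: "M *v x = 0" "x \<bullet> x = 1" "A *v x = of_real l *s x"
    by blast
  have ux: "cinner (u i) x = 0" "cinner x (u i) = 0" if "i \<in> I" for i
    using x(1) that M cinner_commute[of x "u i"] by auto
  have xx: "cinner x x = 1"
    using x(2) by (simp add: cinner_self)
  show ?case
    using insert.hyps e o x(3) ux xx
    by (intro exI[of _ "u(k := x)"] exI[of _ "d(k := l)"]) auto
qed simp

theorem hermitian_spectral:
  fixes A :: "complex ^ 'n ^ 'n"
  assumes A: "hermitian A"
  obtains U d where "unitary_matrix U" "A = U ** real_diag d ** cadjoint U"
proof -
  obtain u :: "'n \<Rightarrow> complex ^ 'n" and d :: "'n \<Rightarrow> real"
    where e: "\<And>i. A *v u i = of_real (d i) *s u i"
      and o: "\<And>i j. cinner (u i) (u j) = (if i = j then 1 else 0)"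
    using hermitian_orthonormal_eigenvectors[OF A, of UNIV] by auto
  define U :: "complex ^ 'n ^ 'n" where "U = (\<chi> a i. u i $ a)"
  have 1: "cadjoint U ** U = mat 1"
    using o by (simp add: vec_eq_iff matrix_matrix_mult_def U_def mat_def cinner_def)
  then have 2: "U ** cadjoint U = mat 1"
    using matrix_left_right_inverse by blast
  have "A ** U = U ** real_diag d"
    using e by (simp add: vec_eq_iff mult_real_diag_nth)
      (simp add: U_def matrix_matrix_mult_def matrix_vector_mult_def vec_eq_iff mult.commute)
  then have "A = U ** real_diag d ** cadjoint U"
    by (metis 2 matrix_mul_assoc matrix_mul_rid)
  then show ?thesis
    using that 1 2 by (simp add: unitary_matrix_def)
qed

section \<open>Traces of diagonalized matrices\<close>

lemma rtrace_add: "rtrace (A + B) = rtrace A + rtrace B"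
  by (simp add: rtrace_def trace_add)

lemma rtrace_diff: "rtrace (A - B) = rtrace A - rtrace B"
  by (simp add: rtrace_def trace_sub)

lemma unitary_cadjoint: "unitary_matrix U \<Longrightarrow> unitary_matrix (cadjoint U)"
  by (simp add: unitary_matrix_def)

lemma unitary_mult:
  assumes "unitary_matrix U" "unitary_matrix V"
  shows "unitary_matrix (U ** V)"
proof -
  have "cadjoint (U ** V) ** (U ** V) = cadjoint V ** (cadjoint U ** U) ** V"
    "(U ** V) ** cadjoint (U ** V) = U ** (V ** cadjoint V) ** cadjoint U"
    by (simp_all add: cadjoint_mult matrix_mul_assoc)
  then show ?thesis
    using assms by (simp add: unitary_matrix_def)
qed

lemma unitary_row_sum:
  assumes "unitary_matrix W"
  shows "(\<Sum>j\<in>UNIV. (cmod (W $ i $ j))\<^sup>2) = 1"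
proof -
  have "(W ** cadjoint W) $ i $ i = 1"
    using assms by (simp add: unitary_matrix_def mat_def)
  then have "(\<Sum>j\<in>UNIV. of_real ((cmod (W $ i $ j))\<^sup>2)) = (1 :: complex)"
    unfolding complex_norm_square by (simp add: matrix_matrix_mult_def)
  then show ?thesis
    by (metis of_real_eq_1_iff of_real_sum)
qed

lemma unitary_column_sum:
  assumes "unitary_matrix W"
  shows "(\<Sum>i\<in>UNIV. (cmod (W $ i $ j))\<^sup>2) = 1"
  using unitary_row_sum[OF unitary_cadjoint[OF assms], of j] by simp

lemma unitary_entry_le:
  assumes "unitary_matrix W"
  shows "cmod (W $ i $ j) \<le> 1"
proof -
  have "(cmod (W $ i $ j))\<^sup>2 \<le> (\<Sum>j\<in>UNIV. (cmod (W $ i $ j))\<^sup>2)"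
    by (rule member_le_sum) auto
  then show ?thesis
    by (simp add: unitary_row_sum[OF assms] power_le_one_iff abs_square_le_1)
qed

text \<open>Cyclicity of the trace gathers the two eigenbases into the overlap matrix
  \<open>cadjoint U ** V\<close>. For unitary \<open>U\<close> and \<open>V\<close> its squared
  moduli have row and column sums 1, so the two spectra are compared with doubly stochastic
  weights.\<close>

lemma rtrace_mult_diagonalized:
  "rtrace ((U ** real_diag a ** cadjoint U) ** (V ** real_diag b ** cadjoint V))
    = (\<Sum>i\<in>UNIV. \<Sum>j\<in>UNIV. a i * b j * (cmod ((cadjoint U ** V) $ i $ j))\<^sup>2)"
proof -
  let ?W = "cadjoint U ** V"
  have "trace ((U ** real_diag a ** cadjoint U) ** (V ** real_diag b ** cadjoint V))
      = trace (U ** (real_diag a ** ?W ** real_diag b ** cadjoint V))"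
    by (simp add: matrix_mul_assoc)
  also have "\<dots> = trace ((real_diag a ** ?W) ** (real_diag b ** cadjoint ?W))"
    by (subst trace_mul_sym) (simp add: matrix_mul_assoc cadjoint_mult)
  also have "\<dots> = (\<Sum>i\<in>UNIV. \<Sum>j\<in>UNIV. of_real (a i) * ?W $ i $ j * (of_real (b j) * cnj (?W $ i $ j)))"
    by (simp add: trace_def matrix_matrix_mult_def[of "real_diag a ** ?W"]
        real_diag_mult_nth)
  also have "\<dots> = (\<Sum>i\<in>UNIV. \<Sum>j\<in>UNIV. of_real (a i * b j * (cmod (?W $ i $ j))\<^sup>2))"
    unfolding of_real_mult complex_norm_square by (simp add: mult_ac)
  also have "\<dots> = of_real (\<Sum>i\<in>UNIV. \<Sum>j\<in>UNIV. a i * b j * (cmod (?W $ i $ j))\<^sup>2)"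
    by simp
  finally show ?thesis
    by (simp add: rtrace_def)
qed

lemma rtrace_mult_same_diagonalized:
  assumes "unitary_matrix U"
  shows "rtrace ((U ** real_diag a ** cadjoint U) ** (U ** real_diag b ** cadjoint U))
    = (\<Sum>i\<in>UNIV. a i * b i)"
proof -
  have "cadjoint U ** U = mat 1"
    using assms by (simp add: unitary_matrix_def)
  then have "rtrace ((U ** real_diag a ** cadjoint U) ** (U ** real_diag b ** cadjoint U))
      = (\<Sum>i\<in>UNIV. \<Sum>j\<in>UNIV. if i = j then a i * b i else 0)"
    unfolding rtrace_mult_diagonalized by (intro sum.cong refl) (simp add: mat_def)
  then show ?thesis
    by simp
qed

lemma rtrace_diagonalized:
  fixes U :: "complex ^ 'n ^ 'n"
  assumes "unitary_matrix U"
  shows "rtrace (U ** real_diag d ** cadjoint U) = (\<Sum>i\<in>UNIV. d i)"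
proof -
  have "real_diag (\<lambda>_. 1) = (mat 1 :: complex ^ 'n ^ 'n)"
    by (simp add: vec_eq_iff real_diag_nth mat_def)
  then have "U ** real_diag (\<lambda>_. 1) ** cadjoint U = mat 1"
    using assms by (simp add: unitary_matrix_def)
  then show ?thesis
    using rtrace_mult_same_diagonalized[OF assms, of d "\<lambda>_. 1"] by simp
qed

lemma diagonalized_nth:
  "(U ** real_diag d ** cadjoint U) $ i $ j = (\<Sum>k\<in>UNIV. U $ i $ k * of_real (d k) * cnj (U $ j $ k))"
  by (simp add: matrix_matrix_mult_def[of "U ** real_diag d"] mult_real_diag_nth)

lemma psd_mult_cadjoint: "psd (B ** cadjoint B)"
proof -
  have "x \<bullet> (B ** cadjoint B *v x) = (cadjoint B *v x) \<bullet> (cadjoint B *v x)" for x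
    unfolding inner_adjoint by (simp add: matrix_vector_mul_assoc)
  then show ?thesis
    by (simp add: psd_def Re_cinner hermitian_def cadjoint_mult)
qed

lemma psd_spectral:
  fixes A :: "complex ^ 'n ^ 'n"
  assumes "psd A"
  obtains U d where "unitary_matrix U" "A = U ** real_diag d ** cadjoint U" "\<And>i. 0 \<le> d i"
proof -
  obtain U d where U: "unitary_matrix U" and A: "A = U ** real_diag d ** cadjoint U"
    using assms hermitian_spectral psd_def by blast
  have "0 \<le> d i" for i
  proof -
    \<comment> \<open>This is column \<open>i\<close> of \<open>U\<close>, an eigenvector, and the
      quadratic form of \<open>A\<close> takes the value \<open>d i\<close> there.\<close>
    let ?u = "U *v axis i 1"
    have UU: "cadjoint U ** U = mat 1"
      using U by (simp add: unitary_matrix_def)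
    have "cadjoint U ** A ** U = (cadjoint U ** U) ** real_diag d ** (cadjoint U ** U)"
      by (simp add: A matrix_mul_assoc)
    then have "cadjoint U ** A ** U = real_diag d"
      by (simp add: UU)
    then have "cadjoint U *v (A *v ?u) = real_diag d *v axis i 1"
      by (simp add: matrix_vector_mul_assoc matrix_mul_assoc)
    then have "(cadjoint U *v (A *v ?u)) $ i
        = (\<Sum>j\<in>UNIV. if j = i then of_real (d i) else 0)"
      by (simp only: matrix_vector_mult_def vec_lambda_beta)
        (intro sum.cong refl, simp add: real_diag_nth axis_def)
    then have "axis i 1 \<bullet> (cadjoint U *v (A *v ?u)) = d i"
      by (simp add: inner_axis')
    moreover have "axis i 1 \<bullet> (cadjoint U *v (A *v ?u)) = ?u \<bullet> (A *v ?u)"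
      using inner_adjoint[of "cadjoint U"] by simp
    ultimately show ?thesis
      using assms by (metis psd_def Re_cinner)
  qed
  then show ?thesis
    using that U A by blast
qed

text \<open>Taking square roots of the eigenvalues gives the factor. Positivity of partial traces
  and of tensor products is then read off from a product \<open>B ** cadjoint B\<close>.\<close>

lemma psd_obtain_factor:
  fixes A :: "complex ^ 'n ^ 'n"
  assumes "psd A"
  obtains B :: "complex ^ 'n ^ 'n" where "A = B ** cadjoint B"
proof -
  obtain U d where U: "unitary_matrix U" and A: "A = U ** real_diag d ** cadjoint U"
    and d: "\<And>i. 0 \<le> d i"
    using psd_spectral[OF assms] by blast
  have "real_diag (\<lambda>i. sqrt (d i)) ** real_diag (\<lambda>i. sqrt (d i)) = real_diag d"
    using d by (simp add: vec_eq_iff mult_real_diag_nth real_diag_nth flip: of_real_mult)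
  then have "A = U ** (real_diag (\<lambda>i. sqrt (d i)) ** real_diag (\<lambda>i. sqrt (d i))) ** cadjoint U"
    by (simp add: A)
  also have "\<dots> = (U ** real_diag (\<lambda>i. sqrt (d i))) ** cadjoint (U ** real_diag (\<lambda>i. sqrt (d i)))"
    by (simp add: cadjoint_mult hermitian_real_diag matrix_mul_assoc)
  finally have "A = (U ** real_diag (\<lambda>i. sqrt (d i))) ** cadjoint (U ** real_diag (\<lambda>i. sqrt (d i)))" .
  then show ?thesis
    using that by blast
qed

text \<open>The entries of a unitary matrix have modulus at most 1, so each entry of
  \<open>A\<close> is bounded by the sum of its nonnegative eigenvalues. On the positive cone the
  trace thus controls the norm and all linear terms.\<close>

lemma psd_entry_le_rtrace:
  assumes "psd A"
  shows "cmod (A $ i $ j) \<le> rtrace A"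
proof -
  obtain U d where U: "unitary_matrix U" and A: "A = U ** real_diag d ** cadjoint U"
    and d: "\<And>i. 0 \<le> d i"
    using psd_spectral[OF assms] by blast
  have "cmod (A $ i $ j) \<le> (\<Sum>k\<in>UNIV. cmod (U $ i $ k * of_real (d k) * cnj (U $ j $ k)))"
    unfolding A diagonalized_nth by (rule norm_sum)
  also have "\<dots> \<le> (\<Sum>k\<in>UNIV. d k)"
  proof (rule sum_mono)
    fix k
    have "cmod (U $ i $ k) * cmod (U $ j $ k) \<le> 1 * 1"
      by (intro mult_mono unitary_entry_le U) auto
    then have "d k * (cmod (U $ i $ k) * cmod (U $ j $ k)) \<le> d k * 1"
      using d by (intro mult_left_mono) auto
    then show "cmod (U $ i $ k * of_real (d k) * cnj (U $ j $ k)) \<le> d k"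
      using d by (simp add: norm_mult mult_ac)
  qed
  finally show ?thesis
    by (simp add: A rtrace_diagonalized[OF U])
qed

lemma psd_rtrace_nonneg: "psd A \<Longrightarrow> 0 \<le> rtrace A"
  using psd_entry_le_rtrace norm_ge_zero order_trans by blast

lemma abs_rtrace_mult_psd_le:
  assumes "psd A"
  shows "\<bar>rtrace (K ** A)\<bar> \<le> (\<Sum>i\<in>UNIV. \<Sum>j\<in>UNIV. cmod (K $ i $ j)) * rtrace A"
proof -
  have "\<bar>rtrace (K ** A)\<bar> \<le> cmod (trace (K ** A))"
    unfolding rtrace_def by (rule abs_Re_le_cmod)
  also have "\<dots> \<le> (\<Sum>i\<in>UNIV. \<Sum>j\<in>UNIV. cmod (K $ i $ j * A $ j $ i))"
    unfolding trace_def matrix_matrix_mult_def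
    by (simp, intro order_trans[OF norm_sum] sum_mono order_trans[OF norm_sum] order_refl)
  also have "\<dots> \<le> (\<Sum>i\<in>UNIV. \<Sum>j\<in>UNIV. cmod (K $ i $ j) * rtrace A)"
    unfolding norm_mult by (intro sum_mono mult_left_mono psd_entry_le_rtrace assms) auto
  finally show ?thesis
    by (simp add: sum_distrib_right)
qed

lemma psd_norm_le:
  fixes A :: "complex ^ 'n ^ 'n"
  assumes "psd A"
  shows "norm A \<le> real CARD('n) * (real CARD('n) * rtrace A)"
proof -
  have "norm A \<le> (\<Sum>i\<in>UNIV. norm (A $ i))"
    by (simp add: norm_vec_def L2_set_le_sum)
  also have "\<dots> \<le> (\<Sum>i::'n\<in>UNIV. \<Sum>j::'n\<in>UNIV. rtrace A)"
  proof (rule sum_mono)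
    fix i
    have "norm (A $ i) \<le> (\<Sum>j\<in>UNIV. cmod (A $ i $ j))"
      by (simp add: norm_vec_def L2_set_le_sum)
    also have "\<dots> \<le> (\<Sum>j::'n\<in>UNIV. rtrace A)"
      by (intro sum_mono psd_entry_le_rtrace assms)
    finally show "norm (A $ i) \<le> (\<Sum>j::'n\<in>UNIV. rtrace A)" .
  qed
  finally show ?thesis
    by simp
qed

lemma rtrace_eq_0_imp_eq_0:
  assumes "psd A" "rtrace A = 0"
  shows "A = 0"
  using psd_norm_le[OF assms(1)] assms(2) by simp

section \<open>Von Neumann entropy\<close>

abbreviation ln0 :: "real \<Rightarrow> real" where
  "ln0 x \<equiv> if x > 0 then ln x else 0"

lemma mlog_diagonalized:
  "unitary_matrix U \<Longrightarrow>
    mlog (U ** real_diag d ** cadjoint U) = U ** real_diag (\<lambda>i. ln0 (d i)) ** cadjoint U"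
  unfolding mlog_def by (rule herm_fun_diagonalized)

lemma rtrace_mult_diff: "rtrace (A ** (B - C)) = rtrace (A ** B) - rtrace (A ** C)"
proof -
  have "A ** (B - C) = A ** B - A ** C"
    by (simp add: vec_eq_iff matrix_matrix_mult_def algebra_simps sum_subtractf)
  then show ?thesis by (simp add: rtrace_diff)
qed

lemma vn_entropy_diagonalized:
  assumes U: "unitary_matrix U" and d: "\<And>i. 0 \<le> d i"
  shows "vn_entropy (U ** real_diag d ** cadjoint U) = (\<Sum>i\<in>UNIV. d i * ln (d i) - d i)"
proof -
  have "vn_entropy (U ** real_diag d ** cadjoint U) = (\<Sum>i\<in>UNIV. d i * ln0 (d i)) - (\<Sum>i\<in>UNIV. d i)"
    by (simp only: vn_entropy_def rtrace_mult_diff mlog_diagonalized[OF U]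
        rtrace_mult_same_diagonalized[OF U] rtrace_diagonalized[OF U] matrix_mul_rid)
  \<comment> \<open>The cutoff acts only where the factor \<open>d i\<close> vanishes. The form with
    plain \<open>ln\<close> is the one whose continuity is established.\<close>
  also have "(\<Sum>i\<in>UNIV. d i * ln0 (d i)) = (\<Sum>i\<in>UNIV. d i * ln (d i))"
    using d by (intro sum.cong refl) (auto simp: less_le)
  finally show ?thesis
    by (simp add: sum_subtractf)
qed

text \<open>The Legendre transform of \<open>x \<mapsto> x ln x - x\<close> is \<open>exp\<close>.\<close>

lemma xlnx_ge_linear:
  fixes x M :: real
  assumes "0 \<le> x"
  shows "M * x - exp M \<le> x * ln x - x"
proof (cases "x = 0")
  case False
  then have x: "0 < x" using assms by simp
  then have "M - ln x \<le> exp M / x - 1"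
    using ln_le_minus_one[of "exp M / x"] by (simp add: ln_div)
  then have "x * (M - ln x) \<le> x * (exp M / x - 1)"
    using x by (intro mult_left_mono) auto
  then show ?thesis
    using x by (simp add: algebra_simps)
qed simp

text \<open>The scalar bound is summed over the eigenvalues. The slope \<open>M\<close> stays free:
  large values absorb linear terms, while \<open>M = 0\<close> gives a lower bound independent of
  the matrix.\<close>

lemma vn_entropy_ge:
  fixes A :: "complex ^ 'n ^ 'n"
  assumes "psd A"
  shows "M * rtrace A - real CARD('n) * exp M \<le> vn_entropy A"
proof -
  obtain U d where U: "unitary_matrix U" and A: "A = U ** real_diag d ** cadjoint U"
    and d: "\<And>i. 0 \<le> d i"
    using psd_spectral[OF assms] by blast
  have "(\<Sum>i\<in>UNIV. M * d i - exp M) \<le> (\<Sum>i\<in>UNIV. d i * ln (d i) - d i)"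
    by (intro sum_mono xlnx_ge_linear d)
  then show ?thesis
    by (simp add: A vn_entropy_diagonalized[OF U d] rtrace_diagonalized[OF U] sum_subtractf
        sum_distrib_left)
qed

text \<open>Only the endpoint 0 is delicate; there \<open>x * ln x\<close> tends to 0 from the
  right. The closed half-line contains all eigenvalues of psd matrices.\<close>

lemma continuous_on_xlnx: "continuous_on {0..} (\<lambda>x::real. x * ln x - x)"
proof -
  have "continuous (at x within {0..}) (\<lambda>x::real. x * ln x)" if "0 \<le> x" for x :: real
  proof (cases "x = 0")
    case True
    have "((\<lambda>x::real. x * ln x) \<longlongrightarrow> 0) (at_right 0)"
      by real_asymp
    then show ?thesis
      using True by (simp add: continuous_within at_within_Ici_at_right)
  next
    case False
    then have "isCont (\<lambda>x::real. x * ln x) x"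
      by (intro continuous_intros)
    then show ?thesis
      by (rule continuous_at_imp_continuous_at_within)
  qed
  then have "continuous_on {0..} (\<lambda>x::real. x * ln x)"
    by (simp add: continuous_on_eq_continuous_within)
  then show ?thesis
    by (intro continuous_on_diff continuous_on_id)
qed

section \<open>Continuity of matrix operations and of the entropy\<close>

lemma tendsto_matrix_mult [tendsto_intros]:
  fixes X :: "'t \<Rightarrow> 'a::real_normed_field ^ 'n ^ 'm" and Y :: "'t \<Rightarrow> 'a ^ 'k ^ 'n"
  assumes "(X \<longlongrightarrow> A) F" "(Y \<longlongrightarrow> B) F"
  shows "((\<lambda>t. X t ** Y t) \<longlongrightarrow> A ** B) F"
  unfolding matrix_matrix_mult_def by (intro tendsto_intros assms)

lemma tendsto_cadjoint [tendsto_intros]: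
  assumes "(X \<longlongrightarrow> A) F"
  shows "((\<lambda>t. cadjoint (X t)) \<longlongrightarrow> cadjoint A) F"
  unfolding cadjoint_def by (intro tendsto_intros assms)

lemma tendsto_trace [tendsto_intros]:
  fixes X :: "'t \<Rightarrow> 'a::real_normed_field ^ 'n ^ 'n"
  assumes "(X \<longlongrightarrow> A) F"
  shows "((\<lambda>t. trace (X t)) \<longlongrightarrow> trace A) F"
  unfolding trace_def by (intro tendsto_intros assms)

lemma tendsto_rtrace [tendsto_intros]:
  assumes "(X \<longlongrightarrow> A) F"
  shows "((\<lambda>t. rtrace (X t)) \<longlongrightarrow> rtrace A) F"
  unfolding rtrace_def by (intro tendsto_intros assms)

lemma tendsto_real_diag [tendsto_intros]:
  fixes x :: "'t \<Rightarrow> real ^ 'n"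
  assumes "(x \<longlongrightarrow> y) F"
  shows "((\<lambda>t. real_diag (($) (x t))) \<longlongrightarrow> real_diag (($) y)) F"
proof -
  have "((\<lambda>t. if i = j then complex_of_real (x t $ i) else 0)
      \<longlongrightarrow> (if i = j then complex_of_real (y $ i) else 0)) F" for i j
    by (cases "i = j") (auto intro!: tendsto_intros assms)
  then show ?thesis
    unfolding real_diag_def by (intro tendsto_vec_lambda)
qed

lemma tendsto_matrix_vector_mult [tendsto_intros]:
  fixes X :: "'t \<Rightarrow> 'a::real_normed_field ^ 'n ^ 'm"
  assumes "(X \<longlongrightarrow> A) F"
  shows "((\<lambda>t. X t *v x) \<longlongrightarrow> A *v x) F"
  unfolding matrix_vector_mult_def by (intro tendsto_intros assms)

lemma psd_limit:
  fixes X :: "nat \<Rightarrow> complex ^ 'n ^ 'n"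
  assumes X: "\<And>n. psd (X n)" and lim: "X \<longlonglongrightarrow> L"
  shows "psd L"
proof -
  have "X \<longlonglongrightarrow> cadjoint L"
    using tendsto_cadjoint[OF lim] X by (simp add: psd_def hermitian_def)
  then have "hermitian L"
    unfolding hermitian_def using lim LIMSEQ_unique by blast
  moreover have "0 \<le> x \<bullet> (L *v x)" for x
  proof (rule LIMSEQ_le_const)
    show "(\<lambda>n. x \<bullet> (X n *v x)) \<longlonglongrightarrow> x \<bullet> (L *v x)"
      by (intro tendsto_intros lim)
    show "\<exists>N. \<forall>n\<ge>N. 0 \<le> x \<bullet> (X n *v x)"
      using X by (auto simp: psd_def Re_cinner)
  qed
  ultimately show ?thesis
    by (simp add: psd_def Re_cinner)
qed

lemma unitary_limit:
  assumes X: "\<And>n. unitary_matrix (X n)" and lim: "X \<longlonglongrightarrow> L"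
  shows "unitary_matrix L"
proof -
  have "(\<lambda>n. cadjoint (X n) ** X n) \<longlonglongrightarrow> cadjoint L ** L"
    "(\<lambda>n. X n ** cadjoint (X n)) \<longlonglongrightarrow> L ** cadjoint L"
    by (intro tendsto_intros lim)+
  then show ?thesis
    using X by (auto simp: unitary_matrix_def dest: LIMSEQ_unique[OF tendsto_const])
qed

text \<open>Eigenvalues and eigenvectors range in a compact set, so along a subsequence the
  diagonalizations converge to a diagonalization of the limit.\<close>

lemma vn_entropy_subseq:
  fixes X :: "nat \<Rightarrow> complex ^ 'n ^ 'n"
  assumes X: "\<And>n. psd (X n)" and lim: "X \<longlonglongrightarrow> L"
  obtains r where "strict_mono r" "(\<lambda>n. vn_entropy (X (r n))) \<longlonglongrightarrow> vn_entropy L"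
proof -
  \<comment> \<open>\<open>real_diag\<close> takes a function, whereas the compactness argument
    needs a Euclidean space; the eigenvalues are therefore stored in a vector \<open>e\<close> and
    read back through \<open>($)\<close>.\<close>
  have "\<exists>U e. unitary_matrix U \<and> X n = U ** real_diag (($) e) ** cadjoint U \<and> (\<forall>i. 0 \<le> e $ i)" for n
  proof -
    obtain U d where U: "unitary_matrix U" "X n = U ** real_diag d ** cadjoint U" "\<And>i. 0 \<le> d i"
      using psd_spectral[OF X[of n]] by blast
    moreover have "($) (\<chi> i. d i) = d" by (simp add: fun_eq_iff)
    ultimately show ?thesis by metis
  qed
  then obtain U and e :: "nat \<Rightarrow> real ^ 'n" where U: "\<And>n. unitary_matrix (U n)"
    and XU: "\<And>n. X n = U n ** real_diag (($) (e n)) ** cadjoint (U n)"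
    and e: "\<And>n i. 0 \<le> e n $ i"
    by metis
  have "bounded (range (\<lambda>n. (U n, e n)))"
  proof -
    have nU: "norm (U n) \<le> real CARD('n) * real CARD('n)" for n
    proof -
      have "norm (U n) \<le> (\<Sum>i\<in>UNIV. norm (U n $ i))"
        by (simp add: norm_vec_def L2_set_le_sum)
      also have "\<dots> \<le> (\<Sum>i::'n\<in>UNIV. \<Sum>j::'n\<in>UNIV. 1)"
      proof (rule sum_mono)
        fix i
        have "norm (U n $ i) \<le> (\<Sum>j\<in>UNIV. cmod (U n $ i $ j))"
          by (simp add: norm_vec_def L2_set_le_sum)
        also have "\<dots> \<le> (\<Sum>j::'n\<in>UNIV. 1)"
          by (intro sum_mono unitary_entry_le U)
        finally show "norm (U n $ i) \<le> (\<Sum>j::'n\<in>UNIV. 1)" .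
      qed
      finally show ?thesis by simp
    qed
    have ne: "norm (e n) \<le> rtrace (X n)" for n
    proof -
      have "norm (e n) \<le> (\<Sum>i\<in>UNIV. norm (e n $ i))"
        by (simp add: norm_vec_def L2_set_le_sum)
      also have "\<dots> = rtrace (X n)"
        using e by (simp add: XU rtrace_diagonalized[OF U])
      finally show ?thesis .
    qed
    have "Bseq (\<lambda>n. rtrace (X n))"
      using tendsto_rtrace[OF lim] convergentI convergent_imp_Bseq by blast
    then obtain B where B: "\<And>n. norm (rtrace (X n)) \<le> B"
      by (auto simp: Bseq_def)
    show ?thesis
      unfolding bounded_iff
    proof (intro exI ballI)
      fix z assume "z \<in> range (\<lambda>n. (U n, e n))"
      then obtain n where z: "z = (U n, e n)" by auto
      have "norm z \<le> norm (U n) + norm (e n)"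
        unfolding z by (rule norm_Pair_le)
      then show "norm z \<le> real CARD('n) * real CARD('n) + B"
        using nU[of n] ne[of n] B[of n] by (simp add: abs_le_iff)
    qed
  qed
  then obtain l r where r: "strict_mono r" and lr: "((\<lambda>n. (U n, e n)) \<circ> r) \<longlonglongrightarrow> l"
    using bounded_imp_convergent_subsequence by blast
  have lU: "(\<lambda>n. U (r n)) \<longlonglongrightarrow> fst l" and le: "(\<lambda>n. e (r n)) \<longlonglongrightarrow> snd l"
    using tendsto_fst[OF lr] tendsto_snd[OF lr] by (simp_all add: o_def)
  have ul: "unitary_matrix (fst l)"
    using unitary_limit[OF _ lU] U by blast
  have el: "0 \<le> snd l $ i" for i
    using tendsto_vec_nth[OF le, of i] e by (intro LIMSEQ_le_const) auto
  have "(\<lambda>n. X (r n)) \<longlonglongrightarrow> fst l ** real_diag (($) (snd l)) ** cadjoint (fst l)"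
    unfolding XU by (intro tendsto_intros lU le)
  moreover have "(\<lambda>n. X (r n)) \<longlonglongrightarrow> L"
    using LIMSEQ_subseq_LIMSEQ[OF lim r] by (simp add: o_def)
  ultimately have L: "L = fst l ** real_diag (($) (snd l)) ** cadjoint (fst l)"
    using LIMSEQ_unique by blast
  have "(\<lambda>n. e (r n) $ i * ln (e (r n) $ i) - e (r n) $ i) \<longlonglongrightarrow> snd l $ i * ln (snd l $ i) - snd l $ i" for i
    by (rule continuous_on_tendsto_compose[OF continuous_on_xlnx])
      (auto intro: tendsto_intros le simp: e el)
  then have "(\<lambda>n. vn_entropy (X (r n))) \<longlonglongrightarrow> vn_entropy L"
    unfolding L XU vn_entropy_diagonalized[OF U e] vn_entropy_diagonalized[OF ul el]
    by (intro tendsto_sum)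
  then show ?thesis
    using that r by blast
qed

text \<open>Subsequence principle: otherwise some subsequence would keep the entropies outside a
  neighbourhood of the limit value, but a further subsequence of it has convergent
  diagonalizations.\<close>

lemma tendsto_vn_entropy:
  fixes X :: "nat \<Rightarrow> complex ^ 'n ^ 'n"
  assumes X: "\<And>n. psd (X n)" and lim: "X \<longlonglongrightarrow> L"
  shows "(\<lambda>n. vn_entropy (X n)) \<longlonglongrightarrow> vn_entropy L"
proof (rule ccontr)
  let ?f = "\<lambda>n. vn_entropy (X n)"
  assume "\<not> ?f \<longlonglongrightarrow> vn_entropy L"
  then obtain S where S: "open S" "vn_entropy L \<in> S" and "\<not> eventually (\<lambda>n. ?f n \<in> S) sequentially"
    unfolding tendsto_def by blast
  then have "infinite {n. ?f n \<notin> S}"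
    by (simp add: cofinite_eq_sequentially[symmetric] eventually_cofinite)
  then obtain r :: "nat \<Rightarrow> nat" where r: "strict_mono r" "\<And>n. ?f (r n) \<notin> S"
    using infinite_enumerate by blast
  have "(\<lambda>n. X (r n)) \<longlonglongrightarrow> L"
    using LIMSEQ_subseq_LIMSEQ[OF lim r(1)] by (simp add: o_def)
  then obtain s where "(\<lambda>n. vn_entropy (X (r (s n)))) \<longlonglongrightarrow> vn_entropy L"
    using vn_entropy_subseq[of "\<lambda>n. X (r n)" L] X by blast
  then have "eventually (\<lambda>n. ?f (r (s n)) \<in> S) sequentially"
    using S by (rule topological_tendstoD)
  then show False
    using r(2) by simp
qed

section \<open>Klein inequality and couplings\<close>

text \<open>The finite branch of \<open>rel_entropy\<close>, kept real-valued and free of the kernel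
  condition, so that continuity in the first argument can be stated along any convergent psd
  sequence.\<close>

definition umegaki :: "complex ^ 'n ^ 'n \<Rightarrow> complex ^ 'n ^ 'n \<Rightarrow> real" where
  "umegaki \<gamma>1 \<gamma>2 = rtrace (\<gamma>1 ** (mlog \<gamma>1 - mlog \<gamma>2 - mat 1) + \<gamma>2)"

lemma umegaki_eq: "umegaki \<gamma>1 \<gamma>2 = vn_entropy \<gamma>1 - rtrace (\<gamma>1 ** mlog \<gamma>2) + rtrace \<gamma>2"
  by (simp add: umegaki_def vn_entropy_def rtrace_add rtrace_mult_diff)

lemma umegaki_0: "umegaki 0 \<gamma> = rtrace \<gamma>"
  by (simp add: umegaki_def matrix_matrix_mult_def zero_vec_def[symmetric])

lemma umegaki_self: "umegaki \<gamma> \<gamma> = 0"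
  by (simp add: umegaki_eq vn_entropy_def rtrace_mult_diff)

text \<open>For positive \<open>a\<close> and \<open>b\<close> the expression equals a (x - 1 - ln
  x) with x = b/a, and the tangent bound ln x \<le> x - 1 is strict unless x = 1. The last
  assumption is the scalar form of the kernel inclusion.\<close>

lemma scalar_klein:
  fixes a b :: real
  assumes "0 \<le> a" "0 \<le> b" "b = 0 \<Longrightarrow> a = 0"
  shows scalar_klein_nonneg: "0 \<le> a * (ln0 a - ln0 b - 1) + b"
    and scalar_klein_eq: "a * (ln0 a - ln0 b - 1) + b = 0 \<Longrightarrow> a = b"
proof -
  have *: "0 \<le> a * (ln0 a - ln0 b - 1) + b \<and> (a * (ln0 a - ln0 b - 1) + b = 0 \<longrightarrow> a = b)"
  proof (cases "a = 0 \<or> b = 0")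
    case False
    then have ab: "0 < a" "0 < b" using assms by auto
    have eq: "a * (ln0 a - ln0 b - 1) + b = a * (b / a - 1 - ln (b / a))"
      using ab by (simp add: ln_div field_simps)
    have "0 \<le> b / a - 1 - ln (b / a)"
      using ln_le_minus_one[of "b / a"] ab by simp
    moreover have "a = b" if "b / a - 1 - ln (b / a) = 0"
      using ln_eq_minus_one[of "b / a"] ab that by simp
    ultimately show ?thesis
      unfolding eq using ab by auto
  qed (use assms in auto)
  then show "0 \<le> a * (ln0 a - ln0 b - 1) + b" by blast
  show "a = b" if "a * (ln0 a - ln0 b - 1) + b = 0" using * that by blast
qed

text \<open>In the two eigenbases the divergence is a sum of scalar divergences weighted by squared
  overlaps. If it vanishes, then \<open>a i = b j\<close> wherever the overlap is nonzero, so the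
  overlap matrix intertwines the two spectra and the matrices coincide.\<close>

lemma klein:
  fixes \<gamma>1 \<gamma>2 :: "complex ^ 'n ^ 'n"
  assumes psd: "psd \<gamma>1" "psd \<gamma>2" and ker: "mat_ker \<gamma>2 \<subseteq> mat_ker \<gamma>1"
  shows umegaki_nonneg: "0 \<le> umegaki \<gamma>1 \<gamma>2"
    and umegaki_eq_0_imp_eq: "umegaki \<gamma>1 \<gamma>2 = 0 \<Longrightarrow> \<gamma>1 = \<gamma>2"
proof -
  obtain U a where U: "unitary_matrix U" and g1: "\<gamma>1 = U ** real_diag a ** cadjoint U"
    and a: "\<And>i. 0 \<le> a i"
    using psd_spectral[OF psd(1)] by blast
  obtain V b where V: "unitary_matrix V" and g2: "\<gamma>2 = V ** real_diag b ** cadjoint V"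
    and b: "\<And>i. 0 \<le> b i"
    using psd_spectral[OF psd(2)] by blast
  define W where "W = cadjoint U ** V"
  have uW: "unitary_matrix W"
    unfolding W_def by (intro unitary_mult unitary_cadjoint U V)
  have uu: "cadjoint U ** U = mat 1" "U ** cadjoint U = mat 1"
    and vv: "cadjoint V ** V = mat 1" "V ** cadjoint V = mat 1"
    using U V by (auto simp: unitary_matrix_def)
  define w where "w i j = (cmod (W $ i $ j))\<^sup>2" for i j
  define g where "g x y = x * (ln0 x - ln0 y - 1) + y" for x y :: real
  have "vn_entropy \<gamma>1 = (\<Sum>i\<in>UNIV. a i * ln0 (a i) - a i)"
    by (simp only: vn_entropy_def rtrace_mult_diff g1 mlog_diagonalized[OF U]
        rtrace_mult_same_diagonalized[OF U] rtrace_diagonalized[OF U] matrix_mul_rid sum_subtractf)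
  \<comment> \<open>Inserting row sums equal to 1 turns the single sum into a double sum matching
    the mixed term; column sums do the same for \<open>rtrace \<gamma>2\<close> below.\<close>
  also have "\<dots> = (\<Sum>i\<in>UNIV. (a i * ln0 (a i) - a i) * (\<Sum>j\<in>UNIV. w i j))"
    unfolding w_def unitary_row_sum[OF uW] by simp
  finally have S: "vn_entropy \<gamma>1 = (\<Sum>i\<in>UNIV. \<Sum>j\<in>UNIV. (a i * ln0 (a i) - a i) * w i j)"
    by (simp only: sum_distrib_left)
  have L: "rtrace (\<gamma>1 ** mlog \<gamma>2) = (\<Sum>i\<in>UNIV. \<Sum>j\<in>UNIV. a i * ln0 (b j) * w i j)"
    by (simp only: g1 g2 mlog_diagonalized[OF V] rtrace_mult_diagonalized w_def W_def)
  have "rtrace \<gamma>2 = (\<Sum>j\<in>UNIV. b j * (\<Sum>i\<in>UNIV. w i j))"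
    unfolding w_def unitary_column_sum[OF uW] g2 rtrace_diagonalized[OF V] by simp
  also have "\<dots> = (\<Sum>i\<in>UNIV. \<Sum>j\<in>UNIV. b j * w i j)"
    unfolding sum_distrib_left by (rule sum.swap)
  finally have T: "rtrace \<gamma>2 = (\<Sum>i\<in>UNIV. \<Sum>j\<in>UNIV. b j * w i j)" .
  have "g (a i) (b j) * w i j
      = (a i * ln0 (a i) - a i) * w i j - a i * ln0 (b j) * w i j + b j * w i j" for i j
    unfolding g_def by (simp only: algebra_simps mult_1_right)
  then have eq: "umegaki \<gamma>1 \<gamma>2 = (\<Sum>i\<in>UNIV. \<Sum>j\<in>UNIV. g (a i) (b j) * w i j)"
    by (simp only: umegaki_eq S L T sum.distrib sum_subtractf)
  \<comment> \<open>The kernel inclusion enters here: if \<open>b j = 0\<close>, column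
    \<open>j\<close> of \<open>V\<close> lies in the kernel of \<open>\<gamma>2\<close>, hence of
    \<open>\<gamma>1\<close>. Pairs violating the hypothesis of the scalar inequality therefore
    carry weight zero.\<close>
  have W0: "a i * cmod (W $ i $ j) = 0" if "b j = 0" for i j
  proof -
    let ?x = "\<chi> k. V $ k $ j"
    have "\<gamma>2 ** V = V ** real_diag b ** (cadjoint V ** V)"
      by (simp add: g2 matrix_mul_assoc)
    then have "(\<gamma>2 ** V) $ k $ j = 0" for k
      using that by (simp add: vv mult_real_diag_nth)
    then have "\<gamma>2 *v ?x = 0"
      by (simp add: vec_eq_iff matrix_matrix_mult_def matrix_vector_mult_def)
    then have "\<gamma>1 *v ?x = 0"
      using ker by (auto simp: mat_ker_def)
    then have "(\<gamma>1 ** V) $ k $ j = 0" for k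
      by (simp add: vec_eq_iff matrix_matrix_mult_def matrix_vector_mult_def)
    then have "(cadjoint U ** (\<gamma>1 ** V)) $ i $ j = 0"
      by (simp add: matrix_matrix_mult_def[of "cadjoint U"])
    moreover have "cadjoint U ** (\<gamma>1 ** V) = (cadjoint U ** U) ** real_diag a ** W"
      by (simp add: g1 W_def matrix_mul_assoc)
    ultimately show ?thesis
      by (simp add: uu real_diag_mult_nth)
  qed
  have nonneg: "0 \<le> g (a i) (b j) * w i j" for i j
  proof (cases "w i j = 0")
    case False
    then have "b j = 0 \<Longrightarrow> a i = 0" using W0[of j i] by (auto simp: w_def)
    then show ?thesis
      unfolding g_def w_def by (intro mult_nonneg_nonneg scalar_klein_nonneg a b) auto
  qed simp
  show "0 \<le> umegaki \<gamma>1 \<gamma>2"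
    unfolding eq by (intro sum_nonneg nonneg)
  show "\<gamma>1 = \<gamma>2" if "umegaki \<gamma>1 \<gamma>2 = 0"
  proof -
    have "g (a i) (b j) * w i j = 0" for i j
      using that unfolding eq
      by (simp add: sum_nonneg_eq_0_iff sum_nonneg nonneg)
    then have "W $ i $ j = 0 \<or> a i = b j" for i j
      using scalar_klein_eq[OF a b, of j i] W0[of j i] by (auto simp: g_def w_def)
    then have "W $ i $ j * of_real (b j) = of_real (a i) * W $ i $ j" for i j
      by (metis mult.commute mult_zero_left)
    then have "W ** real_diag b = real_diag a ** W"
      by (simp add: vec_eq_iff mult_real_diag_nth real_diag_mult_nth)
    then have "U ** (W ** real_diag b) ** cadjoint V = U ** (real_diag a ** W) ** cadjoint V"
      by simp
    moreover have "U ** (W ** real_diag b) ** cadjoint V = (U ** cadjoint U) ** V ** real_diag b ** cadjoint V"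
      "U ** (real_diag a ** W) ** cadjoint V = U ** real_diag a ** cadjoint U ** (V ** cadjoint V)"
      by (simp_all add: W_def matrix_mul_assoc)
    ultimately show ?thesis
      by (simp add: g1 g2 uu vv)
  qed
qed

section \<open>Partial traces, the product coupling and compactness\<close>

lemma sum_UNIV_prod:
  fixes f :: "'a::finite \<times> 'b::finite \<Rightarrow> 'c::comm_monoid_add"
  shows "(\<Sum>p\<in>UNIV. f p) = (\<Sum>i\<in>UNIV. \<Sum>k\<in>UNIV. f (i, k))"
  by (simp add: sum.cartesian_product)

text \<open>Write \<open>\<Gamma>\<close> as \<open>B ** cadjoint B\<close>. Moving the traced-out
  row index of \<open>B\<close> into the column index gives a rectangular \<open>D\<close> for which
  the partial trace is \<open>D ** cadjoint D\<close>.\<close>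

lemma psd_marginal1:
  fixes \<Gamma> :: "complex ^ ('a::finite \<times> 'b::finite) ^ ('a \<times> 'b)"
  assumes "psd \<Gamma>"
  shows "psd (marginal1 \<Gamma>)"
proof -
  obtain B :: "complex ^ ('a \<times> 'b) ^ ('a \<times> 'b)" where B: "\<Gamma> = B ** cadjoint B"
    using psd_obtain_factor[OF assms] by blast
  define D :: "complex ^ ('b \<times> 'a \<times> 'b) ^ 'a" where "D = (\<chi> i p. B $ (i, fst p) $ snd p)"
  have "marginal1 \<Gamma> = D ** cadjoint D"
    by (simp add: vec_eq_iff marginal1_def B D_def matrix_matrix_mult_def sum_UNIV_prod)
  then show ?thesis by (simp add: psd_mult_cadjoint)
qed

lemma psd_marginal2:
  fixes \<Gamma> :: "complex ^ ('a::finite \<times> 'b::finite) ^ ('a \<times> 'b)"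
  assumes "psd \<Gamma>"
  shows "psd (marginal2 \<Gamma>)"
proof -
  obtain B :: "complex ^ ('a \<times> 'b) ^ ('a \<times> 'b)" where B: "\<Gamma> = B ** cadjoint B"
    using psd_obtain_factor[OF assms] by blast
  define D :: "complex ^ ('a \<times> 'a \<times> 'b) ^ 'b" where "D = (\<chi> k p. B $ (fst p, k) $ snd p)"
  have "marginal2 \<Gamma> = D ** cadjoint D"
    by (simp add: vec_eq_iff marginal2_def B D_def matrix_matrix_mult_def sum_UNIV_prod)
  then show ?thesis by (simp add: psd_mult_cadjoint)
qed

lemma trace_marginal1: "trace (marginal1 \<Gamma>) = trace \<Gamma>"
  by (simp add: trace_def marginal1_def sum_UNIV_prod)

lemma tendsto_marginal1 [tendsto_intros]:
  "(X \<longlongrightarrow> A) F \<Longrightarrow> ((\<lambda>t. marginal1 (X t)) \<longlongrightarrow> marginal1 A) F"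
  unfolding marginal1_def by (intro tendsto_intros)

lemma tendsto_marginal2 [tendsto_intros]:
  "(X \<longlongrightarrow> A) F \<Longrightarrow> ((\<lambda>t. marginal2 (X t)) \<longlongrightarrow> marginal2 A) F"
  unfolding marginal2_def by (intro tendsto_intros)

lemma hermitian_trace_real:
  assumes "hermitian A"
  shows "trace A = of_real (rtrace A)"
proof -
  have "cnj (A $ i $ i) = A $ i $ i" for i
    using assms unfolding hermitian_def by (metis cadjoint_nth)
  then have "cnj (trace A) = trace A"
    by (simp add: trace_def)
  then show ?thesis
    by (simp add: rtrace_def complex_eq_iff)
qed

text \<open>The normalised tensor product of the two marginals is a coupling. If their common trace
  vanishes, both are zero and the zero matrix serves instead.\<close>

lemma coupling_exists:
  fixes \<rho> :: "complex ^ 'a ^ 'a" and \<sigma> :: "complex ^ 'b ^ 'b"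
  assumes psd: "psd \<rho>" "psd \<sigma>" and tr: "trace \<rho> = trace \<sigma>"
  obtains \<Gamma> where "psd \<Gamma>" "marginal1 \<Gamma> = \<rho>" "marginal2 \<Gamma> = \<sigma>"
proof (cases "rtrace \<rho> = 0")
  case True
  then have "rtrace \<sigma> = 0" using tr by (simp add: rtrace_def)
  then have "\<rho> = 0" "\<sigma> = 0"
    using True psd by (auto intro: rtrace_eq_0_imp_eq_0)
  then show ?thesis
    using that[of 0] by (simp add: psd_def hermitian_def Re_cinner vec_eq_iff marginal1_def marginal2_def)
next
  case False
  define m where "m = rtrace \<rho>"
  have m: "0 < m" using False psd_rtrace_nonneg[OF psd(1)] by (simp add: m_def)
  have tr_m: "trace \<rho> = of_real m" "trace \<sigma> = of_real m"
    using hermitian_trace_real[of \<rho>] psd(1) tr by (simp_all add: m_def psd_def)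
  obtain B :: "complex ^ 'a ^ 'a" where B: "\<rho> = B ** cadjoint B"
    using psd_obtain_factor[OF psd(1)] by blast
  obtain D :: "complex ^ 'b ^ 'b" where D: "\<sigma> = D ** cadjoint D"
    using psd_obtain_factor[OF psd(2)] by blast
  \<comment> \<open>\<open>E\<close> is the tensor product of the two factors divided by the square
    root of the mass, so \<open>E ** cadjoint E\<close> is the normalised product and its positivity
    is immediate.\<close>
  define E :: "complex ^ ('a \<times> 'b) ^ ('a \<times> 'b)"
    where "E = (\<chi> p q. B $ fst p $ fst q * D $ snd p $ snd q / of_real (sqrt m))"
  define \<Gamma> where "\<Gamma> = E ** cadjoint E"
  have sm: "of_real (sqrt m) * of_real (sqrt m) = (of_real m :: complex)"
    using m by (simp flip: of_real_mult)
  have \<Gamma>: "\<Gamma> $ (i, k) $ (j, l) = \<rho> $ i $ j * \<sigma> $ k $ l / of_real m" for i j k l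
    unfolding \<Gamma>_def B D
    by (simp add: matrix_matrix_mult_def E_def sum_UNIV_prod sum_product sum_divide_distrib sm mult_ac)
  have "marginal1 \<Gamma> $ i $ j = \<rho> $ i $ j * trace \<sigma> / of_real m" for i j
    by (simp add: marginal1_def \<Gamma> trace_def sum_distrib_left sum_divide_distrib)
  moreover have "marginal2 \<Gamma> $ k $ l = trace \<rho> * \<sigma> $ k $ l / of_real m" for k l
    by (simp add: marginal2_def \<Gamma> trace_def sum_distrib_right sum_divide_distrib)
  ultimately have "marginal1 \<Gamma> = \<rho>" "marginal2 \<Gamma> = \<sigma>"
    using m by (simp_all add: vec_eq_iff tr_m)
  then show ?thesis
    using that[of \<Gamma>] by (simp add: \<Gamma>_def psd_mult_cadjoint)
qed

lemma psd_bounded_convergent_subseq: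
  fixes X :: "nat \<Rightarrow> complex ^ 'n ^ 'n"
  assumes "\<And>n. psd (X n)" "\<And>n. rtrace (X n) \<le> B"
  obtains L r where "strict_mono r" "(\<lambda>n. X (r n)) \<longlonglongrightarrow> L"
proof -
  have "norm (X n) \<le> real CARD('n) * (real CARD('n) * B)" for n
    by (intro order_trans[OF psd_norm_le] mult_left_mono assms) auto
  then have "bounded (range X)"
    unfolding bounded_iff by blast
  then obtain L r where "strict_mono r" "(X \<circ> r) \<longlonglongrightarrow> L"
    using bounded_imp_convergent_subsequence by blast
  then show ?thesis
    using that by (simp add: o_def)
qed

lemma weakstar_limitI: "X \<longlonglongrightarrow> L \<Longrightarrow> weakstar_limit X L"
  unfolding weakstar_limit_def by (intro allI tendsto_intros)

section \<open>The two limits\<close>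

text \<open>With the second argument fixed, \<open>mlog \<gamma>\<close> is a constant matrix, so
  the entropy of the first argument is the only nonlinear term.\<close>

lemma tendsto_umegaki:
  assumes "\<And>n. psd (X n)" "X \<longlonglongrightarrow> L"
  shows "(\<lambda>n. umegaki (X n) \<gamma>) \<longlonglongrightarrow> umegaki L \<gamma>"
  unfolding umegaki_eq by (intro tendsto_intros tendsto_vn_entropy assms)

lemma rel_entropy_umegaki:
  "rel_entropy \<gamma>1 \<gamma>2 = (if mat_ker \<gamma>2 \<subseteq> mat_ker \<gamma>1 then ereal (umegaki \<gamma>1 \<gamma>2) else \<infinity>)"
  by (simp add: rel_entropy_def umegaki_def)

text \<open>For each fixed kernel vector of \<open>A\<close> the equation
  \<open>X n *v x = 0\<close> passes to the limit.\<close>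

lemma mat_ker_subset_limit:
  assumes "\<And>n. mat_ker A \<subseteq> mat_ker (X n)" "X \<longlonglongrightarrow> L"
  shows "mat_ker A \<subseteq> mat_ker L"
proof
  fix x assume "x \<in> mat_ker A"
  then have "X n *v x = 0" for n
    using assms(1) by (auto simp: mat_ker_def)
  moreover have "(\<lambda>n. X n *v x) \<longlonglongrightarrow> L *v x"
    by (intro tendsto_intros assms)
  ultimately show "x \<in> mat_ker L"
    by (simp add: mat_ker_def LIMSEQ_const_iff)
qed

section \<open>Real-valued form of the functionals where they are finite\<close>

locale transport =
  fixes C :: "complex ^ ('a::finite \<times> 'b::finite) ^ ('a \<times> 'b)"
    and \<rho> :: "complex ^ 'a ^ 'a"
    and \<sigma> :: "complex ^ 'b ^ 'b"
  assumes psd_\<rho>: "psd \<rho>" and psd_\<sigma>: "psd \<sigma>"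
begin

text \<open>For positive penalty weights this is exactly the part of the psd cone on which the
  unbalanced functionals are finite.\<close>

definition admissible :: "complex ^ ('a \<times> 'b) ^ ('a \<times> 'b) \<Rightarrow> bool" where
  "admissible \<Gamma> \<longleftrightarrow> psd \<Gamma> \<and> mat_ker \<rho> \<subseteq> mat_ker (marginal1 \<Gamma>) \<and> mat_ker \<sigma> \<subseteq> mat_ker (marginal2 \<Gamma>)"

definition balanced_cost :: "real \<Rightarrow> complex ^ ('a \<times> 'b) ^ ('a \<times> 'b) \<Rightarrow> real" where
  "balanced_cost \<epsilon> \<Gamma> = rtrace (C ** \<Gamma>) + \<epsilon> * vn_entropy \<Gamma>"

definition penalty1 where "penalty1 \<Gamma> = umegaki (marginal1 \<Gamma>) \<rho>"

definition penalty2 where "penalty2 \<Gamma> = umegaki (marginal2 \<Gamma>) \<sigma>"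

definition unbalanced_cost where "unbalanced_cost \<tau>1 \<tau>2 \<epsilon> \<Gamma> = balanced_cost \<epsilon> \<Gamma> + \<tau>1 * penalty1 \<Gamma> + \<tau>2 * penalty2 \<Gamma>"

text \<open>Entrywise sum norm, which bounds the linear term by \<open>c_C * rtrace \<Gamma>\<close>
  on the positive cone; \<open>c_\<rho>\<close> plays the same role for the mixed term of the first
  relative entropy.\<close>

definition c_C where "c_C = (\<Sum>i\<in>UNIV. \<Sum>j\<in>UNIV. cmod (C $ i $ j))"

definition c_\<rho> where "c_\<rho> = (\<Sum>i\<in>UNIV. \<Sum>j\<in>UNIV. cmod (mlog \<rho> $ i $ j))"

lemma admissible_psd: "admissible \<Gamma> \<Longrightarrow> psd \<Gamma>"
  by (simp add: admissible_def)

lemma penalty1_nonneg: "admissible \<Gamma> \<Longrightarrow> 0 \<le> penalty1 \<Gamma>"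
  unfolding penalty1_def admissible_def by (intro umegaki_nonneg psd_marginal1 psd_\<rho>) auto

lemma penalty2_nonneg: "admissible \<Gamma> \<Longrightarrow> 0 \<le> penalty2 \<Gamma>"
  unfolding penalty2_def admissible_def by (intro umegaki_nonneg psd_marginal2 psd_\<sigma>) auto

lemma penalty1_eq_0D: "admissible \<Gamma> \<Longrightarrow> penalty1 \<Gamma> = 0 \<Longrightarrow> marginal1 \<Gamma> = \<rho>"
  unfolding penalty1_def admissible_def by (intro umegaki_eq_0_imp_eq psd_marginal1 psd_\<rho>) auto

lemma penalty2_eq_0D: "admissible \<Gamma> \<Longrightarrow> penalty2 \<Gamma> = 0 \<Longrightarrow> marginal2 \<Gamma> = \<sigma>"
  unfolding penalty2_def admissible_def by (intro umegaki_eq_0_imp_eq psd_marginal2 psd_\<sigma>) auto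

lemma coupling_admissible:
  assumes "psd \<Gamma>" "marginal1 \<Gamma> = \<rho>" "marginal2 \<Gamma> = \<sigma>"
  shows "admissible \<Gamma>" and "unbalanced_cost \<tau>1 \<tau>2 \<epsilon> \<Gamma> = balanced_cost \<epsilon> \<Gamma>"
  using assms by (simp_all add: admissible_def unbalanced_cost_def penalty1_def penalty2_def umegaki_self)

lemma F_unbalanced_admissible:
  "admissible \<Gamma> \<Longrightarrow> F_unbalanced C \<rho> \<sigma> \<tau>1 \<tau>2 \<epsilon> \<Gamma> = ereal (unbalanced_cost \<tau>1 \<tau>2 \<epsilon> \<Gamma>)"
  by (simp add: F_unbalanced_def rel_entropy_umegaki admissible_def unbalanced_cost_def balanced_cost_def penalty1_def penalty2_def)

lemma F_unbalanced_not_admissible: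
  "psd \<Gamma> \<Longrightarrow> \<not> admissible \<Gamma> \<Longrightarrow> 0 < \<tau>1 \<Longrightarrow> 0 < \<tau>2 \<Longrightarrow> F_unbalanced C \<rho> \<sigma> \<tau>1 \<tau>2 \<epsilon> \<Gamma> = \<infinity>"
  by (auto simp: F_unbalanced_def rel_entropy_umegaki admissible_def)

text \<open>The entropy is a finite real, so its product with 0 vanishes. Facts proved for all
  \<open>\<epsilon>\<close> thereby cover the limit functional too.\<close>

lemma F_unbalanced0_eq: "F_unbalanced0 C \<rho> \<sigma> \<tau>1 \<tau>2 = F_unbalanced C \<rho> \<sigma> \<tau>1 \<tau>2 0"
  by (simp add: fun_eq_iff F_unbalanced_def F_unbalanced0_def)

text \<open>The zero matrix is the universal competitor: its cost is finite and independent of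
  \<open>\<epsilon>\<close>, which makes minimal values finite and bounds them uniformly.\<close>

lemma admissible_0: "admissible 0"
  by (simp add: admissible_def psd_def hermitian_def Re_cinner vec_eq_iff mat_ker_def
      marginal1_def marginal2_def matrix_vector_mult_def zero_vec_def[symmetric])

lemma unbalanced_cost_0: "unbalanced_cost \<tau>1 \<tau>2 \<epsilon> 0 = \<tau>1 * rtrace \<rho> + \<tau>2 * rtrace \<sigma>"
proof -
  have [simp]: "marginal1 (0 :: complex ^ ('a \<times> 'b) ^ ('a \<times> 'b)) = 0"
    "marginal2 (0 :: complex ^ ('a \<times> 'b) ^ ('a \<times> 'b)) = 0"
    by (simp_all add: vec_eq_iff marginal1_def marginal2_def)
  have [simp]: "A ** 0 = 0" "0 ** A = 0" for A :: "complex ^ ('a \<times> 'b) ^ ('a \<times> 'b)"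
    by (simp_all add: vec_eq_iff matrix_matrix_mult_def)
  show ?thesis
    by (simp add: unbalanced_cost_def balanced_cost_def penalty1_def penalty2_def umegaki_0 vn_entropy_def) (simp add: rtrace_def trace_def)
qed

text \<open>Since the zero matrix has finite value, no minimizer can sit at infinity, and
  minimization over the psd cone reduces to a real-valued problem on \<open>admissible\<close>. No
  sign of \<open>\<epsilon>\<close> is imposed, so \<open>\<epsilon> = 0\<close> is
  included.\<close>

lemma is_arg_min_F_unbalanced_iff:
  assumes "0 < \<tau>1" "0 < \<tau>2"
  shows "is_arg_min (F_unbalanced C \<rho> \<sigma> \<tau>1 \<tau>2 \<epsilon>) psd \<Gamma> \<longleftrightarrow>
    admissible \<Gamma> \<and> (\<forall>\<Gamma>'. admissible \<Gamma>' \<longrightarrow> unbalanced_cost \<tau>1 \<tau>2 \<epsilon> \<Gamma> \<le> unbalanced_cost \<tau>1 \<tau>2 \<epsilon> \<Gamma>')"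
    (is "?L \<longleftrightarrow> ?R")
proof
  assume L: ?L
  then have "psd \<Gamma>" and min: "\<And>\<Gamma>'. psd \<Gamma>' \<Longrightarrow>
      F_unbalanced C \<rho> \<sigma> \<tau>1 \<tau>2 \<epsilon> \<Gamma> \<le> F_unbalanced C \<rho> \<sigma> \<tau>1 \<tau>2 \<epsilon> \<Gamma>'"
    by (auto simp: is_arg_min_linorder)
  have adm: "admissible \<Gamma>"
  proof (rule ccontr)
    assume "\<not> admissible \<Gamma>"
    then show False
      using min[of 0] assms \<open>psd \<Gamma>\<close> admissible_0
      by (simp add: F_unbalanced_not_admissible F_unbalanced_admissible admissible_psd)
  qed
  then show ?R
    using min by (metis F_unbalanced_admissible admissible_psd ereal_less_eq(3))
next
  assume R: ?R
  have "F_unbalanced C \<rho> \<sigma> \<tau>1 \<tau>2 \<epsilon> \<Gamma> \<le> F_unbalanced C \<rho> \<sigma> \<tau>1 \<tau>2 \<epsilon> \<Gamma>'" if "psd \<Gamma>'" for \<Gamma>'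
    using that R assms
    by (cases "admissible \<Gamma>'") (simp_all add: F_unbalanced_not_admissible F_unbalanced_admissible)
  then show ?L
    using R by (simp add: is_arg_min_linorder admissible_psd)
qed

section \<open>Closedness of the domain and continuity of the costs\<close>

lemma admissible_limit:
  assumes "\<And>n. admissible (X n)" "X \<longlonglongrightarrow> L"
  shows "admissible L"
  unfolding admissible_def
proof (intro conjI)
  show "psd L"
    using psd_limit assms admissible_psd by blast
  show "mat_ker \<rho> \<subseteq> mat_ker (marginal1 L)"
    using assms(1) by (intro mat_ker_subset_limit[OF _ tendsto_marginal1[OF assms(2)]])
      (simp add: admissible_def)
  show "mat_ker \<sigma> \<subseteq> mat_ker (marginal2 L)"
    using assms(1) by (intro mat_ker_subset_limit[OF _ tendsto_marginal2[OF assms(2)]])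
      (simp add: admissible_def)
qed

lemma tendsto_penalty1:
  assumes "\<And>n. admissible (X n)" "X \<longlonglongrightarrow> L"
  shows "(\<lambda>n. penalty1 (X n)) \<longlonglongrightarrow> penalty1 L"
  unfolding penalty1_def by (intro tendsto_umegaki psd_marginal1 admissible_psd tendsto_intros assms)

lemma tendsto_penalty2:
  assumes "\<And>n. admissible (X n)" "X \<longlonglongrightarrow> L"
  shows "(\<lambda>n. penalty2 (X n)) \<longlonglongrightarrow> penalty2 L"
  unfolding penalty2_def by (intro tendsto_umegaki psd_marginal2 admissible_psd tendsto_intros assms)

lemma tendsto_balanced_cost:
  assumes "\<And>n. admissible (X n)" "X \<longlonglongrightarrow> L"
  shows "(\<lambda>n. balanced_cost \<epsilon> (X n)) \<longlonglongrightarrow> balanced_cost \<epsilon> L"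
  unfolding balanced_cost_def by (intro tendsto_intros tendsto_vn_entropy admissible_psd assms)

lemma tendsto_unbalanced_cost:
  assumes "\<And>n. admissible (X n)" "X \<longlonglongrightarrow> L"
  shows "(\<lambda>n. unbalanced_cost \<tau>1 \<tau>2 \<epsilon> (X n)) \<longlonglongrightarrow> unbalanced_cost \<tau>1 \<tau>2 \<epsilon> L"
  unfolding unbalanced_cost_def by (intro tendsto_intros tendsto_balanced_cost tendsto_penalty1 tendsto_penalty2 assms)

section \<open>Coercivity: trace bounds from cost bounds\<close>

lemma rtrace_C_ge:
  assumes "psd \<Gamma>"
  shows "- (c_C * rtrace \<Gamma>) \<le> rtrace (C ** \<Gamma>)"
  using abs_rtrace_mult_psd_le[OF assms, of C] by (simp add: c_C_def abs_le_iff)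

lemma vn_entropy_ge_const: "psd \<Gamma> \<Longrightarrow> - real CARD('a \<times> 'b) \<le> vn_entropy \<Gamma>"
  for \<Gamma> :: "complex ^ ('a \<times> 'b) ^ ('a \<times> 'b)"
  using vn_entropy_ge[of \<Gamma> 0] by simp

text \<open>The entropy bound is applied to the first marginal, which has the same trace as
  \<open>\<Gamma>\<close>. The slope loses \<open>c_\<rho>\<close> to the mixed term, and the
  nonnegative trace of \<open>\<rho>\<close> is dropped.\<close>

lemma penalty1_ge:
  assumes "psd \<Gamma>"
  shows "(M - c_\<rho>) * rtrace \<Gamma> - real CARD('a) * exp M \<le> penalty1 \<Gamma>"
proof -
  have p: "psd (marginal1 \<Gamma>)" by (rule psd_marginal1[OF assms])
  have t: "rtrace (marginal1 \<Gamma>) = rtrace \<Gamma>" by (simp add: rtrace_def trace_marginal1)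
  have "rtrace (marginal1 \<Gamma> ** mlog \<rho>) = rtrace (mlog \<rho> ** marginal1 \<Gamma>)"
    unfolding rtrace_def by (subst trace_mul_sym) (rule refl)
  then show ?thesis
    using vn_entropy_ge[OF p, of M] abs_rtrace_mult_psd_le[OF p, of "mlog \<rho>"] psd_rtrace_nonneg[OF psd_\<rho>]
    by (simp add: penalty1_def umegaki_eq t c_\<rho>_def abs_le_iff algebra_simps)
qed

text \<open>The slope (c_C + 1)/\<epsilon> is chosen so that the entropy term outweighs the linear
  cost and leaves exactly one copy of the trace.\<close>

lemma balanced_cost_coercive:
  assumes "psd \<Gamma>" "0 < \<epsilon>"
  shows "rtrace \<Gamma> - \<epsilon> * (real CARD('a \<times> 'b) * exp ((c_C + 1) / \<epsilon>)) \<le> balanced_cost \<epsilon> \<Gamma>"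
proof -
  let ?M = "(c_C + 1) / \<epsilon>"
  have "\<epsilon> * (?M * rtrace \<Gamma> - real CARD('a \<times> 'b) * exp ?M) \<le> \<epsilon> * vn_entropy \<Gamma>"
    using assms by (intro mult_left_mono vn_entropy_ge) auto
  moreover have "\<epsilon> * (?M * rtrace \<Gamma> - real CARD('a \<times> 'b) * exp ?M)
      = c_C * rtrace \<Gamma> + rtrace \<Gamma> - \<epsilon> * (real CARD('a \<times> 'b) * exp ?M)"
    using assms(2) by (simp add: field_simps)
  ultimately show ?thesis
    unfolding balanced_cost_def using rtrace_C_ge[OF assms(1)] by linarith
qed

text \<open>Growth comes from the first relative entropy rather than from the regularization, so the
  bound is uniform in \<open>\<epsilon>\<close>. The entropy contributes only its constant lower
  bound, scaled by \<open>\<epsilon> \<le> 1\<close>, and the second penalty only its sign.\<close>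

lemma unbalanced_cost_coercive:
  assumes "admissible \<Gamma>" "0 < \<tau>1" "0 < \<tau>2" "0 < \<epsilon>" "\<epsilon> \<le> 1"
  shows "rtrace \<Gamma> - real CARD('a \<times> 'b) - \<tau>1 * (real CARD('a) * exp (c_\<rho> + (c_C + 1) / \<tau>1)) \<le> unbalanced_cost \<tau>1 \<tau>2 \<epsilon> \<Gamma>"
proof -
  let ?M = "c_\<rho> + (c_C + 1) / \<tau>1"
  have p: "psd \<Gamma>" using assms admissible_psd by blast
  have "\<tau>1 * ((?M - c_\<rho>) * rtrace \<Gamma> - real CARD('a) * exp ?M) \<le> \<tau>1 * penalty1 \<Gamma>"
    using assms by (intro mult_left_mono penalty1_ge p) auto
  moreover have "\<tau>1 * ((?M - c_\<rho>) * rtrace \<Gamma> - real CARD('a) * exp ?M)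
      = c_C * rtrace \<Gamma> + rtrace \<Gamma> - \<tau>1 * (real CARD('a) * exp ?M)"
    using assms(2) by (simp add: field_simps)
  moreover have "0 \<le> \<tau>2 * penalty2 \<Gamma>"
    using assms penalty2_nonneg by simp
  moreover have "- real CARD('a \<times> 'b) \<le> \<epsilon> * vn_entropy \<Gamma>"
  proof -
    have "\<epsilon> * (- real CARD('a \<times> 'b)) \<le> \<epsilon> * vn_entropy \<Gamma>"
      using assms by (intro mult_left_mono vn_entropy_ge_const p) auto
    moreover have "\<epsilon> * real CARD('a \<times> 'b) \<le> 1 * real CARD('a \<times> 'b)"
      using assms by (intro mult_right_mono) auto
    ultimately show ?thesis by linarith
  qed
  ultimately show ?thesis
    unfolding unbalanced_cost_def balanced_cost_def using rtrace_C_ge[OF p] by linarith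
qed

section \<open>Vanishing regularization and infinitely strong marginal penalties\<close>

lemma unbalanced_cost_eq_unregularized: "unbalanced_cost \<tau>1 \<tau>2 \<epsilon> \<Gamma> = unbalanced_cost \<tau>1 \<tau>2 0 \<Gamma> + \<epsilon> * vn_entropy \<Gamma>"
  by (simp add: unbalanced_cost_def balanced_cost_def)

lemma vanishing_regularization:
  assumes \<tau>: "0 < \<tau>1" "0 < \<tau>2"
    and adm: "\<And>\<epsilon>. 0 < \<epsilon> \<Longrightarrow> admissible (\<Gamma> \<epsilon>)"
    and min: "\<And>\<epsilon> \<Gamma>'. 0 < \<epsilon> \<Longrightarrow> admissible \<Gamma>' \<Longrightarrow> unbalanced_cost \<tau>1 \<tau>2 \<epsilon> (\<Gamma> \<epsilon>) \<le> unbalanced_cost \<tau>1 \<tau>2 \<epsilon> \<Gamma>'"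
  obtains L e where "admissible L" "\<And>k :: nat. 0 < e k" "e \<longlonglongrightarrow> 0" "(\<lambda>k. \<Gamma> (e k)) \<longlonglongrightarrow> L"
    "((\<lambda>\<epsilon>. unbalanced_cost \<tau>1 \<tau>2 \<epsilon> (\<Gamma> \<epsilon>)) \<longlongrightarrow> unbalanced_cost \<tau>1 \<tau>2 0 L) (at_right 0)"
    "\<And>\<Gamma>'. admissible \<Gamma>' \<Longrightarrow> unbalanced_cost \<tau>1 \<tau>2 0 L \<le> unbalanced_cost \<tau>1 \<tau>2 0 \<Gamma>'"
proof -
  let ?N = "real CARD('a \<times> 'b)"
  \<comment> \<open>The cost of the zero competitor plus the constants subtracted in the coercivity
    estimate.\<close>
  define B where "B = \<tau>1 * rtrace \<rho> + \<tau>2 * rtrace \<sigma> + ?N + \<tau>1 * (real CARD('a) * exp (c_\<rho> + (c_C + 1) / \<tau>1))"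
  \<comment> \<open>The shift by one avoids division by zero and keeps \<open>d k\<close> in (0, 1],
    where the coercivity estimate applies.\<close>
  define d where "d k = 1 / real (Suc k)" for k
  have d: "0 < d k" "d k \<le> 1" for k by (simp_all add: d_def)
  have d0: "d \<longlonglongrightarrow> 0" unfolding d_def by (rule LIMSEQ_Suc[OF lim_1_over_n])
  have p: "psd (\<Gamma> (d k))" for k
    by (rule admissible_psd[OF adm[OF d(1)]])
  have b: "rtrace (\<Gamma> (d k)) \<le> B" for k
    using unbalanced_cost_coercive[OF adm[OF d(1)] \<tau> d(1) d(2), of k k] min[OF d(1) admissible_0, of k]
    unfolding unbalanced_cost_0 B_def by linarith
  obtain L r where r: "strict_mono r" and L: "(\<lambda>n. \<Gamma> (d (r n))) \<longlonglongrightarrow> L"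
    by (rule psd_bounded_convergent_subseq[of "\<lambda>n. \<Gamma> (d n)", OF p b])
  define e where "e k = d (r k)" for k
  have e: "0 < e k" for k by (simp add: e_def d)
  have e0: "e \<longlonglongrightarrow> 0"
    using LIMSEQ_subseq_LIMSEQ[OF d0 r] by (simp add: o_def e_def[abs_def])
  have eL: "(\<lambda>k. \<Gamma> (e k)) \<longlonglongrightarrow> L"
    using L by (simp add: e_def)
  have admL: "admissible L"
    using admissible_limit[OF _ eL] adm e by blast
  have S: "- ?N \<le> vn_entropy \<Gamma>'" if "admissible \<Gamma>'" for \<Gamma>'
    using vn_entropy_ge_const admissible_psd that by blast
  have minL: "unbalanced_cost \<tau>1 \<tau>2 0 L \<le> unbalanced_cost \<tau>1 \<tau>2 0 \<Gamma>'" if \<Gamma>': "admissible \<Gamma>'" for \<Gamma>'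
  proof (rule LIMSEQ_le)
    show "(\<lambda>k. unbalanced_cost \<tau>1 \<tau>2 0 (\<Gamma> (e k))) \<longlonglongrightarrow> unbalanced_cost \<tau>1 \<tau>2 0 L"
      using tendsto_unbalanced_cost[OF _ eL] adm e by blast
    have "(\<lambda>k. unbalanced_cost \<tau>1 \<tau>2 0 \<Gamma>' + e k * (vn_entropy \<Gamma>' + ?N)) \<longlonglongrightarrow> unbalanced_cost \<tau>1 \<tau>2 0 \<Gamma>' + 0 * (vn_entropy \<Gamma>' + ?N)"
      by (intro tendsto_intros e0)
    then show "(\<lambda>k. unbalanced_cost \<tau>1 \<tau>2 0 \<Gamma>' + e k * (vn_entropy \<Gamma>' + ?N)) \<longlonglongrightarrow> unbalanced_cost \<tau>1 \<tau>2 0 \<Gamma>'"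
      by simp
    \<comment> \<open>Minimality at \<open>e k\<close> compares regularized costs; the uniform lower
      bound on the entropy converts this to unregularized costs up to an error of order
      \<open>e k\<close>.\<close>
    have "unbalanced_cost \<tau>1 \<tau>2 0 (\<Gamma> (e k)) \<le> unbalanced_cost \<tau>1 \<tau>2 0 \<Gamma>' + e k * (vn_entropy \<Gamma>' + ?N)" for k
    proof -
      have "e k * (- ?N) \<le> e k * vn_entropy (\<Gamma> (e k))"
        using e[of k] S[OF adm[OF e]] by (intro mult_left_mono) auto
      then show ?thesis
        using min[OF e \<Gamma>', of k] unfolding unbalanced_cost_eq_unregularized[of _ _ "e k"] by (simp add: algebra_simps)
    qed
    then show "\<exists>N. \<forall>n\<ge>N. unbalanced_cost \<tau>1 \<tau>2 0 (\<Gamma> (e n)) \<le> unbalanced_cost \<tau>1 \<tau>2 0 \<Gamma>' + e n * (vn_entropy \<Gamma>' + ?N)"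
      by blast
  qed
  \<comment> \<open>Both bounds hold for every positive \<open>\<epsilon>\<close>, so the values
    converge along the full limit although \<open>L\<close> was obtained from a subsequence.\<close>
  have "((\<lambda>\<epsilon>. unbalanced_cost \<tau>1 \<tau>2 \<epsilon> (\<Gamma> \<epsilon>)) \<longlongrightarrow> unbalanced_cost \<tau>1 \<tau>2 0 L) (at_right 0)"
  proof (rule tendsto_sandwich)
    have pos: "eventually (\<lambda>\<epsilon>::real. 0 < \<epsilon>) (at_right 0)"
      by (rule eventually_at_right_less)
    have "unbalanced_cost \<tau>1 \<tau>2 0 L + \<epsilon> * (- ?N) \<le> unbalanced_cost \<tau>1 \<tau>2 \<epsilon> (\<Gamma> \<epsilon>)" if "0 < \<epsilon>" for \<epsilon>
      unfolding unbalanced_cost_eq_unregularized[of _ _ \<epsilon>]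
      using that by (intro add_mono minL mult_left_mono S adm) auto
    then show "eventually (\<lambda>\<epsilon>. unbalanced_cost \<tau>1 \<tau>2 0 L + \<epsilon> * (- ?N) \<le> unbalanced_cost \<tau>1 \<tau>2 \<epsilon> (\<Gamma> \<epsilon>)) (at_right 0)"
      using pos by (rule eventually_mono[rotated])
    have "unbalanced_cost \<tau>1 \<tau>2 \<epsilon> (\<Gamma> \<epsilon>) \<le> unbalanced_cost \<tau>1 \<tau>2 0 L + \<epsilon> * vn_entropy L" if "0 < \<epsilon>" for \<epsilon>
      using min[OF that admL] by (simp add: unbalanced_cost_eq_unregularized[of _ _ \<epsilon>])
    then show "eventually (\<lambda>\<epsilon>. unbalanced_cost \<tau>1 \<tau>2 \<epsilon> (\<Gamma> \<epsilon>) \<le> unbalanced_cost \<tau>1 \<tau>2 0 L + \<epsilon> * vn_entropy L) (at_right 0)"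
      using pos by (rule eventually_mono[rotated])
    have "((\<lambda>\<epsilon>. unbalanced_cost \<tau>1 \<tau>2 0 L + \<epsilon> * c) \<longlongrightarrow> unbalanced_cost \<tau>1 \<tau>2 0 L + 0 * c) (at_right 0)" for c
      by (intro tendsto_intros)
    then show "((\<lambda>\<epsilon>. unbalanced_cost \<tau>1 \<tau>2 0 L + \<epsilon> * (- ?N)) \<longlongrightarrow> unbalanced_cost \<tau>1 \<tau>2 0 L) (at_right 0)"
      "((\<lambda>\<epsilon>. unbalanced_cost \<tau>1 \<tau>2 0 L + \<epsilon> * vn_entropy L) \<longlongrightarrow> unbalanced_cost \<tau>1 \<tau>2 0 L) (at_right 0)"
      by (simp_all only: mult_zero_left add_0_right)
  qed
  then show ?thesis
    using that[OF admL e e0 eL _ minL] by blast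
qed

text \<open>Here \<open>\<epsilon>\<close> is fixed, so the entropy itself provides compactness
  uniformly in the penalty weight, and the growing weight only has to force the penalties to
  zero.\<close>

lemma stiff_marginals:
  assumes \<epsilon>: "0 < \<epsilon>" and tr: "trace \<rho> = trace \<sigma>"
    and adm: "\<And>\<tau>. 0 < \<tau> \<Longrightarrow> admissible (\<Gamma> \<tau>)"
    and min: "\<And>\<tau> \<Gamma>'. 0 < \<tau> \<Longrightarrow> admissible \<Gamma>' \<Longrightarrow> unbalanced_cost \<tau> \<tau> \<epsilon> (\<Gamma> \<tau>) \<le> unbalanced_cost \<tau> \<tau> \<epsilon> \<Gamma>'"
  obtains L t where "psd L" "marginal1 L = \<rho>" "marginal2 L = \<sigma>"
    "\<And>k :: nat. 0 < t k" "filterlim t at_top sequentially" "(\<lambda>k. \<Gamma> (t k)) \<longlonglongrightarrow> L"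
    "((\<lambda>\<tau>. unbalanced_cost \<tau> \<tau> \<epsilon> (\<Gamma> \<tau>)) \<longlongrightarrow> balanced_cost \<epsilon> L) at_top"
    "\<And>\<Gamma>'. psd \<Gamma>' \<Longrightarrow> marginal1 \<Gamma>' = \<rho> \<Longrightarrow> marginal2 \<Gamma>' = \<sigma> \<Longrightarrow> balanced_cost \<epsilon> L \<le> balanced_cost \<epsilon> \<Gamma>'"
proof -
  obtain P where P: "psd P" "marginal1 P = \<rho>" "marginal2 P = \<sigma>"
    using coupling_exists[OF psd_\<rho> psd_\<sigma> tr] .
  \<comment> \<open>The constant of the coercivity estimate. It is independent of
    \<open>\<tau>\<close>, and \<open>- D\<close> is a lower bound for the balanced cost.\<close>
  define D where "D = \<epsilon> * (real CARD('a \<times> 'b) * exp ((c_C + 1) / \<epsilon>))"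
  have balanced_cost_ge: "rtrace (\<Gamma> \<tau>) - D \<le> balanced_cost \<epsilon> (\<Gamma> \<tau>)" "- D \<le> balanced_cost \<epsilon> (\<Gamma> \<tau>)" if "0 < \<tau>" for \<tau>
    using balanced_cost_coercive[OF admissible_psd[OF adm[OF that]] \<epsilon>]
      psd_rtrace_nonneg[OF admissible_psd[OF adm[OF that]]] by (simp_all add: D_def)
  have R: "0 \<le> penalty1 (\<Gamma> \<tau>)" "0 \<le> penalty2 (\<Gamma> \<tau>)" if "0 < \<tau>" for \<tau>
    using that adm penalty1_nonneg penalty2_nonneg by blast+
  have GH: "balanced_cost \<epsilon> (\<Gamma> \<tau>) \<le> unbalanced_cost \<tau> \<tau> \<epsilon> (\<Gamma> \<tau>)" if "0 < \<tau>" for \<tau>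
    using R[OF that] that by (simp add: unbalanced_cost_def)
  \<comment> \<open>Both penalties vanish at a coupling, so every coupling bounds the minimal value
    from above uniformly in \<open>\<tau>\<close>.\<close>
  have GP: "unbalanced_cost \<tau> \<tau> \<epsilon> (\<Gamma> \<tau>) \<le> balanced_cost \<epsilon> P'"
    if "0 < \<tau>" "psd P'" "marginal1 P' = \<rho>" "marginal2 P' = \<sigma>" for \<tau> P'
    using min[OF that(1) coupling_admissible(1)[OF that(2-4)]] coupling_admissible(2)[OF that(2-4)]
    by simp
  define s where "s k = real (Suc k)" for k
  have s: "0 < s k" for k by (simp add: s_def)
  have p: "psd (\<Gamma> (s k))" for k
    by (rule admissible_psd[OF adm[OF s]])
  have b: "rtrace (\<Gamma> (s k)) \<le> balanced_cost \<epsilon> P + D" for k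
    using balanced_cost_ge(1)[OF s[of k]] GH[OF s[of k]] GP[OF s[of k] P] by linarith
  obtain L r where r: "strict_mono r" and L: "(\<lambda>n. \<Gamma> (s (r n))) \<longlonglongrightarrow> L"
    by (rule psd_bounded_convergent_subseq[of "\<lambda>n. \<Gamma> (s n)", OF p b])
  define t where "t k = s (r k)" for k
  have t: "0 < t k" for k by (simp add: t_def s)
  have "filterlim s at_top sequentially"
    unfolding s_def using filterlim_real_sequentially filterlim_sequentially_Suc by blast
  then have t_top: "filterlim t at_top sequentially"
    unfolding t_def by (rule filterlim_compose) (rule filterlim_subseq[OF r])
  have tL: "(\<lambda>k. \<Gamma> (t k)) \<longlonglongrightarrow> L"
    using L by (simp add: t_def)
  have adm_t: "admissible (\<Gamma> (t k))" for k
    using adm t by blast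
  have admL: "admissible L"
    by (rule admissible_limit[OF adm_t tL])
  \<comment> \<open>After weighting by \<open>t k\<close>, the penalties fill at most the gap
    between the cost of \<open>P\<close> and the lower bound \<open>- D\<close>; dividing by
    \<open>t k\<close> sends their sum to zero.\<close>
  have RL: "penalty1 L + penalty2 L \<le> 0"
  proof (rule LIMSEQ_le)
    show "(\<lambda>k. penalty1 (\<Gamma> (t k)) + penalty2 (\<Gamma> (t k))) \<longlonglongrightarrow> penalty1 L + penalty2 L"
      by (intro tendsto_intros tendsto_penalty1 tendsto_penalty2 adm_t tL)
    show "(\<lambda>k. (balanced_cost \<epsilon> P + D) / t k) \<longlonglongrightarrow> 0"
      using t_top by (intro tendsto_divide_0[OF tendsto_const] filterlim_at_top_imp_at_infinity)
    have "penalty1 (\<Gamma> (t k)) + penalty2 (\<Gamma> (t k)) \<le> (balanced_cost \<epsilon> P + D) / t k" for k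
    proof -
      have "t k * (penalty1 (\<Gamma> (t k)) + penalty2 (\<Gamma> (t k))) \<le> balanced_cost \<epsilon> P + D"
        using balanced_cost_ge(2)[OF t[of k]] GP[OF t[of k] P] by (simp add: unbalanced_cost_def algebra_simps)
      then show ?thesis
        using t[of k] by (simp add: field_simps)
    qed
    then show "\<exists>N. \<forall>n\<ge>N. penalty1 (\<Gamma> (t n)) + penalty2 (\<Gamma> (t n)) \<le> (balanced_cost \<epsilon> P + D) / t n"
      by blast
  qed
  then have "penalty1 L = 0" "penalty2 L = 0"
    using penalty1_nonneg[OF admL] penalty2_nonneg[OF admL] by simp_all
  then have LM: "psd L" "marginal1 L = \<rho>" "marginal2 L = \<sigma>"
    using penalty1_eq_0D penalty2_eq_0D admL admissible_psd by blast+
  have HL: "(\<lambda>k. balanced_cost \<epsilon> (\<Gamma> (t k))) \<longlonglongrightarrow> balanced_cost \<epsilon> L"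
    by (rule tendsto_balanced_cost[OF adm_t tL])
  have minL: "balanced_cost \<epsilon> L \<le> balanced_cost \<epsilon> P'" if "psd P'" "marginal1 P' = \<rho>" "marginal2 P' = \<sigma>" for P'
    by (rule LIMSEQ_le_const2[OF HL]) (use GH[OF t] GP[OF t that] in \<open>auto intro: order_trans\<close>)
  \<comment> \<open>The minimizer for the larger weight is used as competitor for the smaller one;
    its nonnegative penalties only grow with the weight.\<close>
  have mono: "unbalanced_cost \<tau> \<tau> \<epsilon> (\<Gamma> \<tau>) \<le> unbalanced_cost \<tau>' \<tau>' \<epsilon> (\<Gamma> \<tau>')" if "0 < \<tau>" "\<tau> \<le> \<tau>'" for \<tau> \<tau>'
  proof -
    have p: "0 < \<tau>'" using that by simp
    have "unbalanced_cost \<tau> \<tau> \<epsilon> (\<Gamma> \<tau>) \<le> unbalanced_cost \<tau> \<tau> \<epsilon> (\<Gamma> \<tau>')"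
      using min[OF that(1) adm[OF p]] .
    also have "\<dots> \<le> unbalanced_cost \<tau>' \<tau>' \<epsilon> (\<Gamma> \<tau>')"
      unfolding unbalanced_cost_def using that R[OF p] by (intro add_mono mult_right_mono) auto
    finally show ?thesis .
  qed
  have "((\<lambda>\<tau>. unbalanced_cost \<tau> \<tau> \<epsilon> (\<Gamma> \<tau>)) \<longlongrightarrow> balanced_cost \<epsilon> L) at_top"
  proof (rule order_tendstoI)
    fix a assume "a < balanced_cost \<epsilon> L"
    then have "eventually (\<lambda>k. a < balanced_cost \<epsilon> (\<Gamma> (t k))) sequentially"
      by (rule order_tendstoD(1)[OF HL])
    \<comment> \<open>One index suffices: monotonicity carries the lower bound from
      \<open>t k\<close> to every larger weight, which upgrades subsequential information to the
      full limit.\<close>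
    then obtain k where k: "a < balanced_cost \<epsilon> (\<Gamma> (t k))"
      using eventually_happens'[OF sequentially_bot] by blast
    have "a < unbalanced_cost \<tau> \<tau> \<epsilon> (\<Gamma> \<tau>)" if "t k \<le> \<tau>" for \<tau>
      using k GH[OF t[of k]] mono[OF t that] by linarith
    then show "eventually (\<lambda>\<tau>. a < unbalanced_cost \<tau> \<tau> \<epsilon> (\<Gamma> \<tau>)) at_top"
      using eventually_ge_at_top[of "t k"] by (rule eventually_mono[rotated])
  next
    fix a assume a: "balanced_cost \<epsilon> L < a"
    have "unbalanced_cost \<tau> \<tau> \<epsilon> (\<Gamma> \<tau>) < a" if "0 < \<tau>" for \<tau>
      using GP[OF that LM] a by linarith
    then show "eventually (\<lambda>\<tau>. unbalanced_cost \<tau> \<tau> \<epsilon> (\<Gamma> \<tau>) < a) at_top"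
      using eventually_gt_at_top[of 0] by (rule eventually_mono[rotated])
  qed
  then show ?thesis
    using that[OF LM t t_top tL _ minL] by blast
qed

end

section \<open>Transfer of both limits to the extended-real functionals\<close>

theorem mainTheorem5:
  fixes C :: "complex ^ ('a::finite \<times> 'b::finite) ^ ('a \<times> 'b)"
    and \<rho> :: "complex ^ 'a ^ 'a"
    and \<sigma> :: "complex ^ 'b ^ 'b"
  assumes "hermitian C" and "psd \<rho>" and "psd \<sigma>"
  shows "(\<forall>\<tau>1 \<tau>2 \<Gamma>. 0 < \<tau>1 \<and> 0 < \<tau>2
            \<and> (\<forall>\<epsilon>>0. is_arg_min (F_unbalanced C \<rho> \<sigma> \<tau>1 \<tau>2 \<epsilon>) psd (\<Gamma> \<epsilon>)) \<longrightarrow>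
          (\<exists>\<Gamma>0. psd \<Gamma>0
            \<and> (\<exists>e :: nat \<Rightarrow> real. (\<forall>k. 0 < e k) \<and> e \<longlonglongrightarrow> 0 \<and> weakstar_limit (\<lambda>k. \<Gamma> (e k)) \<Gamma>0)
            \<and> ((\<lambda>\<epsilon>. F_unbalanced C \<rho> \<sigma> \<tau>1 \<tau>2 \<epsilon> (\<Gamma> \<epsilon>)) \<longlongrightarrow> F_unbalanced0 C \<rho> \<sigma> \<tau>1 \<tau>2 \<Gamma>0)
                (at_right 0)
            \<and> is_arg_min (F_unbalanced0 C \<rho> \<sigma> \<tau>1 \<tau>2) psd \<Gamma>0))
       \<and> (\<forall>\<epsilon> \<Gamma>. 0 < \<epsilon> \<and> trace \<rho> = trace \<sigma>
            \<and> (\<forall>\<tau>>0. is_arg_min (F_unbalanced C \<rho> \<sigma> \<tau> \<tau> \<epsilon>) psd (\<Gamma> \<tau>)) \<longrightarrow>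
          (\<exists>\<Gamma>i. psd \<Gamma>i
            \<and> (\<exists>t :: nat \<Rightarrow> real. (\<forall>k. 0 < t k) \<and> filterlim t at_top sequentially
                 \<and> weakstar_limit (\<lambda>k. \<Gamma> (t k)) \<Gamma>i)
            \<and> ((\<lambda>\<tau>. F_unbalanced C \<rho> \<sigma> \<tau> \<tau> \<epsilon> (\<Gamma> \<tau>)) \<longlongrightarrow> F_balanced C \<rho> \<sigma> \<epsilon> \<Gamma>i) at_top
            \<and> is_arg_min (F_balanced C \<rho> \<sigma> \<epsilon>)
                (\<lambda>\<Gamma>'. psd \<Gamma>' \<and> marginal1 \<Gamma>' = \<rho> \<and> marginal2 \<Gamma>' = \<sigma>) \<Gamma>i
            \<and> (density_matrix \<rho> \<and> density_matrix \<sigma> \<longrightarrow>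
                 couples \<Gamma>i \<rho> \<sigma>
                 \<and> F_balanced C \<rho> \<sigma> \<epsilon> \<Gamma>i
                   = (INF \<Gamma>'\<in>{\<Gamma>'. couples \<Gamma>' \<rho> \<sigma>}. ereal (rtrace (C ** \<Gamma>') + \<epsilon> * vn_entropy \<Gamma>')))))"
proof (intro conjI allI impI)
  interpret transport C \<rho> \<sigma>
    using assms(2,3) by unfold_locales
  fix \<tau>1 \<tau>2 :: real and \<Gamma>
  assume "0 < \<tau>1 \<and> 0 < \<tau>2 \<and> (\<forall>\<epsilon>>0. is_arg_min (F_unbalanced C \<rho> \<sigma> \<tau>1 \<tau>2 \<epsilon>) psd (\<Gamma> \<epsilon>))"
  then have \<tau>: "0 < \<tau>1" "0 < \<tau>2"
    and am: "\<And>\<epsilon>. 0 < \<epsilon> \<Longrightarrow> is_arg_min (F_unbalanced C \<rho> \<sigma> \<tau>1 \<tau>2 \<epsilon>) psd (\<Gamma> \<epsilon>)"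
    by simp_all
  have adm: "\<And>\<epsilon>. 0 < \<epsilon> \<Longrightarrow> admissible (\<Gamma> \<epsilon>)"
    and min: "\<And>\<epsilon> \<Gamma>'. 0 < \<epsilon> \<Longrightarrow> admissible \<Gamma>' \<Longrightarrow> unbalanced_cost \<tau>1 \<tau>2 \<epsilon> (\<Gamma> \<epsilon>) \<le> unbalanced_cost \<tau>1 \<tau>2 \<epsilon> \<Gamma>'"
    using am by (simp_all add: is_arg_min_F_unbalanced_iff[OF \<tau>])
  obtain L e where L: "admissible L" "\<And>k :: nat. 0 < e k" "e \<longlonglongrightarrow> 0" "(\<lambda>k. \<Gamma> (e k)) \<longlonglongrightarrow> L"
    and lim: "((\<lambda>\<epsilon>. unbalanced_cost \<tau>1 \<tau>2 \<epsilon> (\<Gamma> \<epsilon>)) \<longlongrightarrow> unbalanced_cost \<tau>1 \<tau>2 0 L) (at_right 0)"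
    and minL: "\<And>\<Gamma>'. admissible \<Gamma>' \<Longrightarrow> unbalanced_cost \<tau>1 \<tau>2 0 L \<le> unbalanced_cost \<tau>1 \<tau>2 0 \<Gamma>'"
    using vanishing_regularization[OF \<tau> adm min] by blast
  have "((\<lambda>\<epsilon>. F_unbalanced C \<rho> \<sigma> \<tau>1 \<tau>2 \<epsilon> (\<Gamma> \<epsilon>)) \<longlongrightarrow> F_unbalanced0 C \<rho> \<sigma> \<tau>1 \<tau>2 L) (at_right 0)"
    unfolding F_unbalanced0_eq F_unbalanced_admissible[OF L(1)]
  proof (rule Lim_transform_eventually)
    show "((\<lambda>\<epsilon>. ereal (unbalanced_cost \<tau>1 \<tau>2 \<epsilon> (\<Gamma> \<epsilon>))) \<longlongrightarrow> ereal (unbalanced_cost \<tau>1 \<tau>2 0 L)) (at_right 0)"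
      using lim by simp
    \<comment> \<open>The real cost represents the functional at admissible matrices, and the
      minimizers are known to be admissible only for positive parameters; hence eventual
      equality.\<close>
    show "\<forall>\<^sub>F \<epsilon> in at_right 0. ereal (unbalanced_cost \<tau>1 \<tau>2 \<epsilon> (\<Gamma> \<epsilon>)) = F_unbalanced C \<rho> \<sigma> \<tau>1 \<tau>2 \<epsilon> (\<Gamma> \<epsilon>)"
      using eventually_at_right_less[of 0]
      by (rule eventually_mono) (simp add: F_unbalanced_admissible adm)
  qed
  moreover have "is_arg_min (F_unbalanced0 C \<rho> \<sigma> \<tau>1 \<tau>2) psd L"
    using L(1) minL by (simp add: F_unbalanced0_eq is_arg_min_F_unbalanced_iff[OF \<tau>])
  ultimately show "\<exists>\<Gamma>0. psd \<Gamma>0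
      \<and> (\<exists>e :: nat \<Rightarrow> real. (\<forall>k. 0 < e k) \<and> e \<longlonglongrightarrow> 0 \<and> weakstar_limit (\<lambda>k. \<Gamma> (e k)) \<Gamma>0)
      \<and> ((\<lambda>\<epsilon>. F_unbalanced C \<rho> \<sigma> \<tau>1 \<tau>2 \<epsilon> (\<Gamma> \<epsilon>)) \<longlongrightarrow> F_unbalanced0 C \<rho> \<sigma> \<tau>1 \<tau>2 \<Gamma>0) (at_right 0)
      \<and> is_arg_min (F_unbalanced0 C \<rho> \<sigma> \<tau>1 \<tau>2) psd \<Gamma>0"
    using L admissible_psd weakstar_limitI by blast
next
  interpret transport C \<rho> \<sigma>
    using assms(2,3) by unfold_locales
  fix \<epsilon> :: real and \<Gamma>
  assume "0 < \<epsilon> \<and> trace \<rho> = trace \<sigma>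
    \<and> (\<forall>\<tau>>0. is_arg_min (F_unbalanced C \<rho> \<sigma> \<tau> \<tau> \<epsilon>) psd (\<Gamma> \<tau>))"
  then have \<epsilon>: "0 < \<epsilon>" and tr: "trace \<rho> = trace \<sigma>"
    and am: "\<And>\<tau>. 0 < \<tau> \<Longrightarrow> is_arg_min (F_unbalanced C \<rho> \<sigma> \<tau> \<tau> \<epsilon>) psd (\<Gamma> \<tau>)"
    by simp_all
  have adm: "\<And>\<tau>. 0 < \<tau> \<Longrightarrow> admissible (\<Gamma> \<tau>)"
    and min: "\<And>\<tau> \<Gamma>'. 0 < \<tau> \<Longrightarrow> admissible \<Gamma>' \<Longrightarrow> unbalanced_cost \<tau> \<tau> \<epsilon> (\<Gamma> \<tau>) \<le> unbalanced_cost \<tau> \<tau> \<epsilon> \<Gamma>'"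
    using am by (simp_all add: is_arg_min_F_unbalanced_iff)
  obtain L t where LM: "psd L" "marginal1 L = \<rho>" "marginal2 L = \<sigma>"
    and t: "\<And>k :: nat. 0 < t k" "filterlim t at_top sequentially" "(\<lambda>k. \<Gamma> (t k)) \<longlonglongrightarrow> L"
    and lim: "((\<lambda>\<tau>. unbalanced_cost \<tau> \<tau> \<epsilon> (\<Gamma> \<tau>)) \<longlongrightarrow> balanced_cost \<epsilon> L) at_top"
    and minL: "\<And>\<Gamma>'. psd \<Gamma>' \<Longrightarrow> marginal1 \<Gamma>' = \<rho> \<Longrightarrow> marginal2 \<Gamma>' = \<sigma> \<Longrightarrow> balanced_cost \<epsilon> L \<le> balanced_cost \<epsilon> \<Gamma>'"
    using stiff_marginals[OF \<epsilon> tr adm min] by blast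
  have FL: "F_balanced C \<rho> \<sigma> \<epsilon> L = ereal (balanced_cost \<epsilon> L)"
    using LM by (simp add: F_balanced_def balanced_cost_def)
  have "((\<lambda>\<tau>. F_unbalanced C \<rho> \<sigma> \<tau> \<tau> \<epsilon> (\<Gamma> \<tau>)) \<longlongrightarrow> F_balanced C \<rho> \<sigma> \<epsilon> L) at_top"
    unfolding FL
  proof (rule Lim_transform_eventually)
    show "((\<lambda>\<tau>. ereal (unbalanced_cost \<tau> \<tau> \<epsilon> (\<Gamma> \<tau>))) \<longlongrightarrow> ereal (balanced_cost \<epsilon> L)) at_top"
      using lim by simp
    show "\<forall>\<^sub>F \<tau> in at_top. ereal (unbalanced_cost \<tau> \<tau> \<epsilon> (\<Gamma> \<tau>)) = F_unbalanced C \<rho> \<sigma> \<tau> \<tau> \<epsilon> (\<Gamma> \<tau>)"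
      using eventually_gt_at_top[of 0]
      by (rule eventually_mono) (simp add: F_unbalanced_admissible adm)
  qed
  moreover have "is_arg_min (F_balanced C \<rho> \<sigma> \<epsilon>)
      (\<lambda>\<Gamma>'. psd \<Gamma>' \<and> marginal1 \<Gamma>' = \<rho> \<and> marginal2 \<Gamma>' = \<sigma>) L"
    using LM minL by (simp add: is_arg_min_linorder F_balanced_def balanced_cost_def)
  moreover have "couples L \<rho> \<sigma> \<and> F_balanced C \<rho> \<sigma> \<epsilon> L
      = (INF \<Gamma>'\<in>{\<Gamma>'. couples \<Gamma>' \<rho> \<sigma>}. ereal (rtrace (C ** \<Gamma>') + \<epsilon> * vn_entropy \<Gamma>'))"
    if "density_matrix \<rho> \<and> density_matrix \<sigma>"
  proof
    \<comment> \<open>The unit trace required by \<open>couples\<close> is inherited from the first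
      marginal.\<close>
    show cL: "couples L \<rho> \<sigma>"
      using LM that trace_marginal1[of L] by (simp add: couples_def density_matrix_def)
    show "F_balanced C \<rho> \<sigma> \<epsilon> L
      = (INF \<Gamma>'\<in>{\<Gamma>'. couples \<Gamma>' \<rho> \<sigma>}. ereal (rtrace (C ** \<Gamma>') + \<epsilon> * vn_entropy \<Gamma>'))"
      unfolding FL balanced_cost_def[symmetric]
      \<comment> \<open>One inequality is minimality of \<open>L\<close> among all psd matrices with
        these marginals; the other holds because \<open>L\<close> itself belongs to the set of
        couplings.\<close>
      by (rule antisym)
        (use cL minL in \<open>auto simp: couples_def density_matrix_def intro!: INF_greatest INF_lower\<close>)
  qed
  ultimately show "\<exists>\<Gamma>i. psd \<Gamma>i
      \<and> (\<exists>t :: nat \<Rightarrow> real. (\<forall>k. 0 < t k) \<and> filterlim t at_top sequentially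
           \<and> weakstar_limit (\<lambda>k. \<Gamma> (t k)) \<Gamma>i)
      \<and> ((\<lambda>\<tau>. F_unbalanced C \<rho> \<sigma> \<tau> \<tau> \<epsilon> (\<Gamma> \<tau>)) \<longlongrightarrow> F_balanced C \<rho> \<sigma> \<epsilon> \<Gamma>i) at_top
      \<and> is_arg_min (F_balanced C \<rho> \<sigma> \<epsilon>)
          (\<lambda>\<Gamma>'. psd \<Gamma>' \<and> marginal1 \<Gamma>' = \<rho> \<and> marginal2 \<Gamma>' = \<sigma>) \<Gamma>i
      \<and> (density_matrix \<rho> \<and> density_matrix \<sigma> \<longrightarrow>
           couples \<Gamma>i \<rho> \<sigma>
           \<and> F_balanced C \<rho> \<sigma> \<epsilon> \<Gamma>i
             = (INF \<Gamma>'\<in>{\<Gamma>'. couples \<Gamma>' \<rho> \<sigma>}. ereal (rtrace (C ** \<Gamma>') + \<epsilon> * vn_entropy \<Gamma>')))"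
    using LM(1) t weakstar_limitI[OF t(3)] by blast
qed

end
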